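(* Suppose that $u(x,y)$ and $v(x,y)$ are words in the free group $F_2=\langle x,y\rangle$ such that $x\mapsto u(x,y)$, $y\mapsto v(x,y)$ defines an automorphism of $F_2$, and such that Wada's conditions $$u(u(x,y),u(v(x,y),z))=u(x,u(y,z)),$$ $$v(u(x,y),u(v(x,y),z))=u(v(x,u(y,z)),v(y,z)),$$ $$v(v(x,y),z)=v(v(x,u(y,z)),v(y,z))$$ hold in the free group on $x,y,z$. Then for any group $G$, the binary operations $R_1,R_2:G\times G\to G$ given by $R_1(x,y)=u(x,y)$, $R_2(x,y)=v(x,y)$ define a birack structure on $G$. Moreover, for any group $G$, the biracks given by $$R_1(x,y)=y^{-1},\quad R_2(x,y)=yxy,$$ and by $$R_1(x,y)=x^{-1}y^{-1}x,\quad R_2(x,y)=y^2x,$$ are biquandles.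
   Context: A birack is a set $X$ with a map $R:X\times X\to X\times X$, $R(a,b)=(R_1(a,b),R_2(a,b))$, such that: (1) $R$ is invertible; (2) for any $A_1,A_3\in X$ there is a unique $A_2\in X$ with $R_1(A_1,A_2)=A_3$; (3) for any $A_2,A_4\in X$ there is a unique $A_1\in X$ with $R_2(A_1,A_2)=A_4$; (4) $R$ satisfies the set-theoretic Yang-Baxter equation $(R\times 1)(1\times R)(R\times 1)=(1\times R)(R\times 1)(1\times R)$ on $X^3$. A biquandle is a birack such that for any $a\in X$ there are unique elements $x_a,y_a\in X$ such that $x_a=R_1(x_a,a)$, $a=R_2(x_a,a)$, $y_a=R_2(a,y_a)$ and $a=R_1(a,y_a)$.
   Formalization: The trivial pair u = x, v = y is excluded: it defines the identity automorphism and satisfies Wada's conditions, but R is then the identity map, and condition (2) of a birack fails on every nontrivial group. *)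

theory Defs
  imports "HOL-Algebra.Group"
begin

section \<open>Free groups\<close>

text \<open>
  The free group on a set S of generators, realised on reduced words. A letter (s, True) stands
  for the generator s and (s, False) for its inverse.
\<close>

definition letter_inv :: "'a \<times> bool \<Rightarrow> 'a \<times> bool"
  where "letter_inv l = (fst l, \<not> snd l)"

definition reduced :: "('a \<times> bool) list \<Rightarrow> bool"
  where "reduced w \<longleftrightarrow> (\<forall>i. Suc i < length w \<longrightarrow> w ! Suc i \<noteq> letter_inv (w ! i))"

fun push_letter :: "'a \<times> bool \<Rightarrow> ('a \<times> bool) list \<Rightarrow> ('a \<times> bool) list"
  where
    "push_letter l [] = [l]"
  | "push_letter l (m # w) = (if m = letter_inv l then w else l # m # w)"

definition free_group :: "'a set \<Rightarrow> ('a \<times> bool) list monoid"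
  where "free_group S =
    \<lparr>carrier = {w. reduced w \<and> fst ` set w \<subseteq> S},
     monoid.mult = (\<lambda>v w. foldr push_letter v w),
     one = []\<rparr>"

definition gen :: "'a \<Rightarrow> ('a \<times> bool) list"
  where "gen s = [(s, True)]"

definition word_eval :: "('g, 'm) monoid_scheme \<Rightarrow> ('a \<Rightarrow> 'g) \<Rightarrow> ('a \<times> bool) list \<Rightarrow> 'g"
  where "word_eval G \<rho> w =
    foldr (\<lambda>l a. (if snd l then \<rho> (fst l) else inv\<^bsub>G\<^esub> \<rho> (fst l)) \<otimes>\<^bsub>G\<^esub> a) w \<one>\<^bsub>G\<^esub>"

text \<open>
  The free groups on x, y and on x, y, z; the generators x, y, z are numbered 0, 1, 2.
\<close>

abbreviation F2 :: "(nat \<times> bool) list monoid"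
  where "F2 \<equiv> free_group {0, 1}"

abbreviation F3 :: "(nat \<times> bool) list monoid"
  where "F3 \<equiv> free_group {0, 1, 2}"

text \<open>
  The value w(a, b) in G of a word w = w(x, y) of F2. With G = F2 or G = F3 this is
  substitution of words.
\<close>

definition subst2 :: "('g, 'm) monoid_scheme \<Rightarrow> (nat \<times> bool) list \<Rightarrow> 'g \<Rightarrow> 'g \<Rightarrow> 'g"
  where "subst2 G w a b = word_eval G (\<lambda>i. if i = 0 then a else b) w"

section \<open>Wada's conditions\<close>

text \<open>
  The trivial pair u = x, v = y also defines an automorphism and satisfies Wada's conditions. It
  gives the identity map R on pairs, which is not a birack on a nontrivial group: R_1(a, _) is
  constant. This pair therefore has to be excluded where a birack is claimed.
\<close>

definition defines_automorphism :: "(nat \<times> bool) list \<Rightarrow> (nat \<times> bool) list \<Rightarrow> bool"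
  where "defines_automorphism u v \<longleftrightarrow> (\<lambda>w. subst2 F2 w u v) \<in> iso F2 F2"

definition wada_conditions :: "(nat \<times> bool) list \<Rightarrow> (nat \<times> bool) list \<Rightarrow> bool"
  where "wada_conditions u v \<longleftrightarrow>
    (let U = subst2 F3 u; V = subst2 F3 v; x = gen 0; y = gen 1; z = gen 2 in
       U (U x y) (U (V x y) z) = U x (U y z) \<and>
       V (U x y) (U (V x y) z) = U (V x (U y z)) (V y z) \<and>
       V (V x y) z = V (V x (U y z)) (V y z))"

section \<open>Biracks and biquandles\<close>

definition R_times_id :: "('x \<times> 'x \<Rightarrow> 'x \<times> 'x) \<Rightarrow> 'x \<times> 'x \<times> 'x \<Rightarrow> 'x \<times> 'x \<times> 'x"
  where "R_times_id R = (\<lambda>(a, b, c). (fst (R (a, b)), snd (R (a, b)), c))"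

definition id_times_R :: "('x \<times> 'x \<Rightarrow> 'x \<times> 'x) \<Rightarrow> 'x \<times> 'x \<times> 'x \<Rightarrow> 'x \<times> 'x \<times> 'x"
  where "id_times_R R = (\<lambda>(a, b, c). (a, R (b, c)))"

definition birack :: "'x set \<Rightarrow> ('x \<times> 'x \<Rightarrow> 'x \<times> 'x) \<Rightarrow> bool"
  where "birack X R \<longleftrightarrow>
    bij_betw R (X \<times> X) (X \<times> X) \<and>
    (\<forall>a1\<in>X. \<forall>a3\<in>X. \<exists>!a2. a2 \<in> X \<and> fst (R (a1, a2)) = a3) \<and>
    (\<forall>a2\<in>X. \<forall>a4\<in>X. \<exists>!a1. a1 \<in> X \<and> snd (R (a1, a2)) = a4) \<and>
    (\<forall>t \<in> X \<times> X \<times> X.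
       (R_times_id R \<circ> id_times_R R \<circ> R_times_id R) t =
       (id_times_R R \<circ> R_times_id R \<circ> id_times_R R) t)"

definition biquandle :: "'x set \<Rightarrow> ('x \<times> 'x \<Rightarrow> 'x \<times> 'x) \<Rightarrow> bool"
  where "biquandle X R \<longleftrightarrow>
    birack X R \<and>
    (\<forall>a\<in>X.
       (\<exists>!x. x \<in> X \<and> x = fst (R (x, a)) \<and> a = snd (R (x, a))) \<and>
       (\<exists>!y. y \<in> X \<and> y = snd (R (a, y)) \<and> a = fst (R (a, y))))"

end

theory Submission
  imports Defs "HOL-Library.Sublist"
begin

text \<open>
  Let \<phi> be the automorphism x \<mapsto> u, y \<mapsto> v, extended to F3 by z \<mapsto> z. The first condition of Wada
  says precisely that T = u(x, u(y, z)) is fixed by \<phi>. Since \<phi> maps the free factor on x, y to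
  itself and fixes z, it acts on a reduced word block by block, so it fixes every block of T between
  two occurrences of z. If y occurs more than once in u then T contains such a block that is a
  nontrivial power of y (otherwise u would be a conjugate of a proper power of y, which cannot
  belong to a basis), so v^n = y^n and v = y by uniqueness of roots; the second condition then forces
  u = x, a contradiction. If y does not occur in u, then T = u is a power of x, so u = x and the
  second condition forces v = y. Hence, for a nontrivial pair, y occurs in u exactly once, and u(a, y)
  = d has a unique solution y in every group. The conditions are invariant under exchanging
  u(x, y) with v(y, x), which gives the same for v. Invertibility and the Yang-Baxter equation are
  identities in free groups and are transported along homomorphisms.
\<close>

section \<open>Free groups of reduced words\<close>

lemma letter_inv_simps [simp]:
  "letter_inv (letter_inv l) = l" "fst (letter_inv l) = fst l" "snd (letter_inv l) \<longleftrightarrow> \<not> snd l"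
  "letter_inv l \<noteq> l" "l \<noteq> letter_inv l"
  by (auto simp: letter_inv_def prod_eq_iff)

lemma letter_inv_eq_iff [simp]: "letter_inv l = letter_inv m \<longleftrightarrow> l = m"
  by (metis letter_inv_simps(1))

lemma reduced_iff_successively: "reduced w \<longleftrightarrow> successively (\<lambda>l m. m \<noteq> letter_inv l) w"
  by (simp add: reduced_def successively_conv_nth)

lemma reduced_Nil [simp]: "reduced []"
  by (simp add: reduced_iff_successively)

lemma reduced_Cons: "reduced (l # w) \<longleftrightarrow> reduced w \<and> (w \<noteq> [] \<longrightarrow> hd w \<noteq> letter_inv l)"
  by (auto simp: reduced_iff_successively successively_Cons)

lemma reduced_append:
  "reduced (v @ w) \<longleftrightarrow>
     reduced v \<and> reduced w \<and> (v \<noteq> [] \<longrightarrow> w \<noteq> [] \<longrightarrow> hd w \<noteq> letter_inv (last v))"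
  by (auto simp: reduced_iff_successively successively_append_iff)

lemma reduced_append_disjoint:
  assumes "reduced v" "reduced w" "v \<noteq> [] \<Longrightarrow> w \<noteq> [] \<Longrightarrow> fst (hd w) \<noteq> fst (last v)"
  shows "reduced (v @ w)"
  using assms by (auto simp: reduced_append)

lemma reduced_replicate [simp]: "reduced (replicate n l)"
  by (induction n) (auto simp: reduced_Cons)

lemma reduced_one_generator:
  assumes "reduced w" "fst ` set w \<subseteq> {i}"
  obtains n b where "w = replicate n (i, b)"
proof -
  have "\<exists>b. w = replicate (length w) (i, b)"
    using assms
  proof (induction w)
    case (Cons l w)
    then obtain b where b: "w = replicate (length w) (i, b)"
      by (auto simp: reduced_Cons)
    show ?case
    proof (cases w)
      case Nil
      with Cons.prems show ?thesis by (cases l) auto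
    next
      case (Cons m w')
      with b have "hd w = (i, b)" by (metis hd_replicate list.size(3) neq_Nil_conv replicate_0)
      with Cons.prems Cons have "l = (i, b)"
        by (cases l) (auto simp: reduced_Cons letter_inv_def)
      with b show ?thesis
        by (metis length_Cons replicate_Suc)
    qed
  qed simp
  with that show thesis by blast
qed

lemma reduced_push_letter: "reduced w \<Longrightarrow> reduced (push_letter l w)"
  by (cases w) (auto simp: reduced_Cons)

lemma push_letter_Cons: "reduced (l # w) \<Longrightarrow> push_letter l w = l # w"
  by (cases w) (auto simp: reduced_Cons)

lemma push_letter_letter_inv:
  "reduced w \<Longrightarrow> push_letter l (push_letter (letter_inv l) w) = w"
  by (cases w) (auto simp: reduced_Cons push_letter_Cons)

lemma reduced_foldr_push_letter: "reduced w \<Longrightarrow> reduced (foldr push_letter v w)"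
  by (induction v) (auto simp: reduced_push_letter)

lemma foldr_push_letter_append: "reduced (v @ w) \<Longrightarrow> foldr push_letter v w = v @ w"
  by (induction v) (auto simp: push_letter_Cons reduced_Cons)

lemma foldr_push_letter_Nil: "reduced v \<Longrightarrow> foldr push_letter v [] = v"
  using foldr_push_letter_append[of v "[]"] by simp

text \<open>Letters act on reduced words and inverse letters act by inverse maps, so a cancellation
  between \<open>l\<close> and \<open>v\<close> does not change the action of the product. This is
  van der Waerden's route to associativity.\<close>

lemma foldr_push_letter_push_letter:
  "reduced w \<Longrightarrow> foldr push_letter (push_letter l v) w = push_letter l (foldr push_letter v w)"
  by (cases v) (auto simp: push_letter_letter_inv reduced_foldr_push_letter)

lemma foldr_push_letter_assoc:
  "reduced w \<Longrightarrow>
     foldr push_letter (foldr push_letter u v) w = foldr push_letter u (foldr push_letter v w)"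
  by (induction u) (auto simp: foldr_push_letter_push_letter)

lemma set_push_letter: "set (push_letter l w) \<subseteq> insert l (set w)"
  by (cases w) auto

lemma set_foldr_push_letter: "set (foldr push_letter v w) \<subseteq> set v \<union> set w"
  by (induction v) (use set_push_letter in fastforce)+

section \<open>Inverse words and the group axioms\<close>

definition winv :: "('a \<times> bool) list \<Rightarrow> ('a \<times> bool) list"
  where "winv w = rev (map letter_inv w)"

lemma winv_simps [simp]:
  "winv [] = []" "winv (l # w) = winv w @ [letter_inv l]" "winv (v @ w) = winv w @ winv v"
  "winv (winv w) = w" "fst ` set (winv w) = fst ` set w" "map fst (winv w) = rev (map fst w)"
  "winv w = [] \<longleftrightarrow> w = []" "length (winv w) = length w"
  by (auto simp: winv_def rev_map image_image o_def)

lemma winv_replicate: "winv (replicate n (i, b)) = replicate n (i, \<not> b)"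
  by (simp add: winv_def letter_inv_def)

lemma reduced_winv [simp]: "reduced (winv w) \<longleftrightarrow> reduced w"
proof -
  have "reduced (winv w)" if "reduced w" for w :: "('a \<times> bool) list"
    using that
  proof (induction w)
    case (Cons l w)
    then show ?case
      by (cases w) (auto simp: reduced_Cons reduced_append)
  qed simp
  from this[of w] this[of "winv w"] show ?thesis by auto
qed

lemma foldr_push_letter_winv:
  "reduced w \<Longrightarrow> foldr push_letter (winv v) (foldr push_letter v w) = w"
proof (induction v)
  case (Cons l v)
  then show ?case
    using push_letter_letter_inv[of "foldr push_letter v w" "letter_inv l"]
    by (simp add: reduced_foldr_push_letter)
qed simp

lemma carrier_free_group: "w \<in> carrier (free_group S) \<longleftrightarrow> reduced w \<and> fst ` set w \<subseteq> S"
  and mult_free_group: "v \<otimes>\<^bsub>free_group S\<^esub> w = foldr push_letter v w"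
  and one_free_group [simp]: "\<one>\<^bsub>free_group S\<^esub> = []"
  by (auto simp: free_group_def)

lemma gen_in_free_group [simp]: "gen s \<in> carrier (free_group S) \<longleftrightarrow> s \<in> S"
  by (simp add: carrier_free_group gen_def reduced_Cons)

lemma group_free_group [simp]: "group (free_group S)"
proof (rule groupI)
  fix v w assume "v \<in> carrier (free_group S)" "w \<in> carrier (free_group S)"
  then show "v \<otimes>\<^bsub>free_group S\<^esub> w \<in> carrier (free_group S)"
    using set_foldr_push_letter[of v w]
    by (fastforce simp: carrier_free_group mult_free_group reduced_foldr_push_letter)
next
  fix w assume w: "w \<in> carrier (free_group S)"
  have "foldr push_letter (winv w) w = []"
    using w foldr_push_letter_winv[of "[]" w]
    by (simp add: carrier_free_group foldr_push_letter_Nil)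
  with w show "\<exists>v\<in>carrier (free_group S). v \<otimes>\<^bsub>free_group S\<^esub> w = \<one>\<^bsub>free_group S\<^esub>"
    by (intro bexI[of _ "winv w"]) (simp_all add: carrier_free_group mult_free_group)
qed (auto simp: carrier_free_group mult_free_group foldr_push_letter_assoc)

lemma inv_free_group:
  assumes "w \<in> carrier (free_group S)"
  shows "inv\<^bsub>free_group S\<^esub> w = winv w"
proof -
  have "foldr push_letter (winv w) w = []"
    using assms foldr_push_letter_winv[of "[]" w]
    by (simp add: carrier_free_group foldr_push_letter_Nil)
  with assms show ?thesis
    by (intro group.inv_equality) (simp_all add: carrier_free_group mult_free_group)
qed

section \<open>Evaluation of words in a group and the universal property\<close>

lemma word_eval_Nil [simp]: "word_eval G \<rho> [] = \<one>\<^bsub>G\<^esub>"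
  and word_eval_Cons: "word_eval G \<rho> (l # w) =
    (if snd l then \<rho> (fst l) else inv\<^bsub>G\<^esub> \<rho> (fst l)) \<otimes>\<^bsub>G\<^esub> word_eval G \<rho> w"
  by (simp_all add: word_eval_def)

lemma word_eval_cong:
  "(\<And>i. i \<in> fst ` set w \<Longrightarrow> \<rho> i = \<rho>' i) \<Longrightarrow> word_eval G \<rho> w = word_eval G \<rho>' w"
  by (induction w) (auto simp: word_eval_Cons)

lemma word_eval_map:
  "word_eval G \<rho> (map (map_prod f id) w) = word_eval G (\<rho> \<circ> f) w"
  by (induction w) (simp_all add: word_eval_Cons)

context group
begin

lemma word_eval_closed [simp]:
  "\<rho> ` fst ` set w \<subseteq> carrier G \<Longrightarrow> word_eval G \<rho> w \<in> carrier G"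
  by (induction w) (auto simp: word_eval_Cons)

lemma word_eval_append:
  assumes "\<rho> ` fst ` (set v \<union> set w) \<subseteq> carrier G"
  shows "word_eval G \<rho> (v @ w) = word_eval G \<rho> v \<otimes> word_eval G \<rho> w"
  using assms
proof (induction v)
  case (Cons l v)
  moreover have "word_eval G \<rho> v \<in> carrier G" "word_eval G \<rho> w \<in> carrier G" "\<rho> (fst l) \<in> carrier G"
    using Cons.prems by (auto intro!: word_eval_closed)
  ultimately show ?case
    by (auto simp: word_eval_Cons m_assoc image_Un)
qed (auto simp: image_Un)

text \<open>A cancelled pair of letters evaluates to the unit, so free reduction does not affect
  values.\<close>

lemma word_eval_push_letter:
  assumes "\<rho> ` fst ` insert l (set w) \<subseteq> carrier G"
  shows "word_eval G \<rho> (push_letter l w) = word_eval G \<rho> (l # w)"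
proof (cases w)
  case (Cons m w')
  have "word_eval G \<rho> w' \<in> carrier G" "\<rho> (fst l) \<in> carrier G"
    using assms by (auto simp: Cons intro!: word_eval_closed)
  then show ?thesis
    by (auto simp: Cons word_eval_Cons m_assoc[symmetric])
qed simp

lemma word_eval_foldr_push_letter:
  assumes "\<rho> ` fst ` (set v \<union> set w) \<subseteq> carrier G"
  shows "word_eval G \<rho> (foldr push_letter v w) = word_eval G \<rho> v \<otimes> word_eval G \<rho> w"
proof -
  have "word_eval G \<rho> (foldr push_letter v w) = word_eval G \<rho> (v @ w)"
    using assms
  proof (induction v)
    case (Cons l v)
    have "\<rho> ` fst ` insert l (set (foldr push_letter v w)) \<subseteq> carrier G"
      using Cons.prems set_foldr_push_letter[of v w] by fastforce
    with Cons show ?case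
      by (simp add: word_eval_push_letter word_eval_Cons)
  qed simp
  with assms show ?thesis by (simp add: word_eval_append)
qed

lemma word_eval_hom:
  assumes "\<rho> ` S \<subseteq> carrier G"
  shows "word_eval G \<rho> \<in> hom (free_group S) G"
proof (rule homI)
  fix v w assume vw: "v \<in> carrier (free_group S)" "w \<in> carrier (free_group S)"
  then have "\<rho> ` fst ` (set v \<union> set w) \<subseteq> carrier G"
    using assms by (fastforce simp: carrier_free_group)
  then show "word_eval G \<rho> (v \<otimes>\<^bsub>free_group S\<^esub> w) = word_eval G \<rho> v \<otimes> word_eval G \<rho> w"
    by (simp add: mult_free_group word_eval_foldr_push_letter)
qed (use assms in \<open>force simp: carrier_free_group intro!: word_eval_closed\<close>)

lemma word_eval_replicate:
  "\<rho> i \<in> carrier G \<Longrightarrow> word_eval G \<rho> (replicate n (i, b)) = (if b then \<rho> i else inv \<rho> i) [^] n"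
  by (induction n) (auto simp: word_eval_Cons nat_pow_Suc2[symmetric] simp del: nat_pow_Suc)

end

lemma hom_word_eval:
  assumes "group G" "group H" "h \<in> hom G H" "\<rho> ` fst ` set w \<subseteq> carrier G"
  shows "h (word_eval G \<rho> w) = word_eval H (h \<circ> \<rho>) w"
proof -
  interpret group_hom G H h
    using assms by (simp add: group_hom_def group_hom_axioms_def)
  show ?thesis
    using assms(4)
  proof (induction w)
    case (Cons l w)
    then have "word_eval G \<rho> w \<in> carrier G" "\<rho> (fst l) \<in> carrier G"
      by (auto intro!: G.word_eval_closed)
    with Cons show ?case by (auto simp: word_eval_Cons)
  qed simp
qed

lemma word_eval_gen:
  assumes "w \<in> carrier (free_group S)"
  shows "word_eval (free_group S) gen w = w"
  using assms
proof (induction w)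
  case (Cons l w)
  have "fst l \<in> S" "w \<in> carrier (free_group S)"
    using Cons.prems by (auto simp: carrier_free_group reduced_Cons)
  moreover have "inv\<^bsub>free_group S\<^esub> gen (fst l) = [(fst l, False)]" if "fst l \<in> S"
    using that by (simp add: inv_free_group) (simp add: gen_def letter_inv_def)
  ultimately show ?case
    using Cons
    by (cases l) (auto simp: word_eval_Cons mult_free_group carrier_free_group gen_def
        push_letter_Cons)
qed simp

text \<open>Products and inverses of reduced words do not depend on the ambient set of generators.
  Later computations can thus take place in the free group on all of them.\<close>

lemma word_eval_free_group_UNIV:
  assumes "\<rho> ` fst ` set w \<subseteq> carrier (free_group S)"
  shows "word_eval (free_group S) \<rho> w = word_eval (free_group UNIV) \<rho> w"
proof -
  have "id \<in> hom (free_group S) (free_group UNIV)"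
    by (auto simp: hom_def carrier_free_group mult_free_group)
  from hom_word_eval[OF _ _ this assms] show ?thesis by simp
qed

section \<open>Cyclic reduction, powers and roots\<close>

text \<open>Mutually inverse end letters are stripped until none remain. The condition
  \<open>reduced (c @ c)\<close> encodes cyclic reducedness: the last letter of \<open>c\<close>
  does not cancel against the first.\<close>

lemma conjugate_cyclically_reduced:
  assumes "reduced w"
  obtains g c where "w = g @ c @ winv g" "reduced (c @ c)" "w \<noteq> [] \<Longrightarrow> c \<noteq> []"
proof -
  have "\<exists>g c. w = g @ c @ winv g \<and> reduced (c @ c) \<and> (w \<noteq> [] \<longrightarrow> c \<noteq> [])"
    using assms
  proof (induction "length w" arbitrary: w rule: less_induct)
    case less
    show ?case
    proof (cases "reduced (w @ w)")
      case True
      then show ?thesis by (intro exI[of _ "[]"] exI[of _ w]) simp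
    next
      case False
      with less.prems have w: "w \<noteq> []" "hd w = letter_inv (last w)"
        by (auto simp: reduced_append)
      then obtain l w1 where lw1: "w = l # w1" by (cases w) auto
      with w have "w1 \<noteq> []" by auto
      with lw1 w obtain w2 where w2: "w = l # w2 @ [letter_inv l]"
        by (cases w1 rule: rev_cases) auto
      \<comment> \<open>An empty \<open>w2\<close> would make \<open>w\<close> a cancelling pair of
        letters.\<close>
      with less.prems have "reduced w2" "w2 \<noteq> []"
        by (auto simp: reduced_Cons reduced_append)
      with less.hyps[of w2] w2 obtain g c
        where "w2 = g @ c @ winv g" "reduced (c @ c)" "c \<noteq> []"
        by auto
      with w2 show ?thesis by (intro exI[of _ "l # g"] exI[of _ c]) simp
    qed
  qed
  with that show thesis by blast
qed

lemma reduced_concat_replicate: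
  assumes "reduced (c @ c)"
  shows "reduced (concat (replicate n c))"
proof (induction n)
  case (Suc n)
  then show ?case
    using assms by (cases n) (auto simp: reduced_append)
qed simp

text \<open>Each inner \<open>winv g @ g\<close> cancels, and \<open>reduced (c @ c)\<close>
  prevents any further cancellation. Exponent 0 is excluded because the right side would then be the
  literal word \<open>g @ winv g\<close>.\<close>

lemma free_group_pow_conjugate:
  fixes c g :: "('a \<times> bool) list"
  assumes red: "reduced (g @ c @ winv g)" "reduced (c @ c)" and "c \<noteq> []" "n \<noteq> 0"
  shows "(g @ c @ winv g) [^]\<^bsub>free_group UNIV\<^esub> n = g @ concat (replicate n c) @ winv g"
proof -
  interpret F: group "free_group (UNIV :: 'a set)" by simp
  let ?w = "g @ c @ winv g"
  have w: "?w \<in> carrier (free_group UNIV)" using red by (simp add: carrier_free_group)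
  have ends: "concat (replicate (Suc n) c) \<noteq> []" "hd (concat (replicate (Suc n) c)) = hd c"
    "last (concat (replicate (Suc n) c)) = last c" for n
    using \<open>c \<noteq> []\<close> by (induction n) auto
  have red_pow: "reduced (g @ concat (replicate (Suc n) c) @ winv g)" for n
  proof -
    from red have "reduced g" "reduced (winv g)" "g \<noteq> [] \<Longrightarrow> hd c \<noteq> letter_inv (last g)"
      "g \<noteq> [] \<Longrightarrow> hd (winv g) \<noteq> letter_inv (last c)"
      using \<open>c \<noteq> []\<close> by (auto simp: reduced_append)
    moreover have "reduced (concat (replicate (Suc n) c))"
      using reduced_concat_replicate[OF red(2)] .
    ultimately show ?thesis
      using ends[of n] by (auto simp: reduced_append hd_append simp del: replicate_Suc concat.simps)
  qed
  have "?w [^]\<^bsub>free_group UNIV\<^esub> Suc n = g @ concat (replicate (Suc n) c) @ winv g" for n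
  proof (induction n)
    case 0
    show ?case using w F.l_one[OF w] by simp
  next
    case (Suc n)
    let ?d = "concat (replicate (Suc n) c)"
    have "?w [^]\<^bsub>free_group UNIV\<^esub> Suc (Suc n) = ?w \<otimes>\<^bsub>free_group UNIV\<^esub> (g @ ?d @ winv g)"
      using w F.nat_pow_Suc2[OF w, of "Suc n"] Suc by simp
    also have "\<dots> = foldr push_letter g (foldr push_letter c (foldr push_letter (winv g) (g @ ?d @ winv g)))"
      by (simp add: mult_free_group)
    also have "foldr push_letter (winv g) (g @ ?d @ winv g) = ?d @ winv g"
    proof -
      have "reduced (?d @ winv g)" using red_pow[of n] unfolding reduced_append[of g] by blast
      then show ?thesis
        using foldr_push_letter_winv[of "?d @ winv g" g] foldr_push_letter_append[OF red_pow[of n]]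
        by simp
    qed
    also have "foldr push_letter c (?d @ winv g) = concat (replicate (Suc (Suc n)) c) @ winv g"
    proof -
      have "reduced (concat (replicate (Suc (Suc n)) c) @ winv g)"
        using red_pow[of "Suc n"] unfolding reduced_append[of g] by blast
      then show ?thesis
        using foldr_push_letter_append[of c "?d @ winv g"] by simp
    qed
    also have "foldr push_letter g \<dots> = g @ concat (replicate (Suc (Suc n)) c) @ winv g"
      using foldr_push_letter_append[OF red_pow[of "Suc n"]] by simp
    finally show ?case .
  qed
  with \<open>n \<noteq> 0\<close> show ?thesis by (metis not0_implies_Suc)
qed

text \<open>In the normal form of powers only the number of copies of the core \<open>c\<close>
  changes. A letter pattern found in a low power therefore persists in higher ones.\<close>

lemma subseq_free_group_pow:
  fixes w :: "('a \<times> bool) list" and m n :: nat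
  assumes "reduced w" "0 < m" "m \<le> n"
  shows "subseq (w [^]\<^bsub>free_group UNIV\<^esub> m) (w [^]\<^bsub>free_group UNIV\<^esub> n)"
proof (cases "w = []")
  case True
  interpret F: group "free_group (UNIV :: 'a set)" by simp
  show ?thesis using True F.nat_pow_one[of m] F.nat_pow_one[of n] by simp
next
  case False
  then obtain g c where w: "w = g @ c @ winv g" "reduced (c @ c)" "c \<noteq> []"
    using conjugate_cyclically_reduced[OF assms(1)] by metis
  have "concat (replicate n c) = concat (replicate m c) @ concat (replicate (n - m) c)"
    using assms(3) by (metis concat_append le_add_diff_inverse replicate_add)
  then have "subseq (g @ concat (replicate m c) @ winv g) (g @ concat (replicate n c) @ winv g)"
    by (simp add: list_emb_append_mono[OF _ list_emb_append_mono[OF _ list_emb_append2]])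
  then show ?thesis
    using assms w free_group_pow_conjugate[of g c m] free_group_pow_conjugate[of g c n] by simp
qed

text \<open>The word \<open>w\<close> is a subsequence of its positive powers; this is
  torsion-freeness.\<close>

lemma free_group_pow_ne_Nil:
  fixes w :: "('a \<times> bool) list" and n :: nat
  assumes "reduced w" "w \<noteq> []" "n \<noteq> 0"
  shows "w [^]\<^bsub>free_group UNIV\<^esub> n \<noteq> []"
proof -
  interpret F: group "free_group (UNIV :: 'a set)" by simp
  have "w [^]\<^bsub>free_group UNIV\<^esub> (1 :: nat) = w"
    using assms by (simp add: carrier_free_group)
  then show ?thesis using subseq_free_group_pow[of w 1 n] assms by auto
qed

text \<open>A nonempty \<open>g\<close> would contribute both a letter and its inverse, which a
  constant word cannot contain.\<close>

lemma replicate_eq_append_winv: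
  assumes "replicate n l = g @ c @ winv g"
  shows "g = []"
proof (rule ccontr)
  assume "g \<noteq> []"
  then have "hd g \<in> set (replicate n l)" "letter_inv (hd g) \<in> set (replicate n l)"
    using assms by (auto simp: winv_def)
  then show False by (metis in_set_replicate letter_inv_simps(5))
qed

text \<open>After cyclic reduction of \<open>w\<close> the constant word has the form g c^n g^{-1},
  so \<open>g\<close> is empty and \<open>c\<close> consists of copies of \<open>l\<close>. This is
  the uniqueness of roots used later.\<close>

lemma free_group_pow_eq_replicate:
  fixes w :: "('a \<times> bool) list" and m n :: nat
  assumes w: "reduced w" and eq: "w [^]\<^bsub>free_group UNIV\<^esub> n = replicate m l" and "m \<noteq> 0"
  obtains k where "w = replicate k l" "k * n = m"
proof -
  interpret F: group "free_group (UNIV :: 'a set)" by simp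
  have n: "n \<noteq> 0"
    using eq \<open>m \<noteq> 0\<close> by (intro notI) simp
  have "w \<noteq> []"
  proof
    assume "w = []"
    then have "replicate m l = []" using eq F.nat_pow_one[of n] by simp
    with \<open>m \<noteq> 0\<close> show False by simp
  qed
  then obtain g c where w: "w = g @ c @ winv g" "reduced (c @ c)" "c \<noteq> []"
    using conjugate_cyclically_reduced[OF assms(1)] by metis
  with assms n have gc: "replicate m l = g @ concat (replicate n c) @ winv g"
    by (metis free_group_pow_conjugate)
  then have "g = []" by (rule replicate_eq_append_winv)
  with w gc have *: "w = c" "replicate m l = concat (replicate n c)" by auto
  have "set c \<subseteq> {l}"
  proof -
    have "set c \<subseteq> set (replicate m l)" using n unfolding *(2) by auto
    then show ?thesis by auto
  qed
  then have "c = replicate (length c) l"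
    by (intro replicate_eqI) auto
  moreover have "length c * n = m"
    using arg_cong[OF *(2), of length] by (simp add: length_concat sum_list_replicate)
  ultimately show thesis using that * by metis
qed

section \<open>Substitutions acting on blocks\<close>

text \<open>
  The generators in H are fixed, and nonempty reduced words over L are sent to nonempty words
  without letters from H. No cancellation then occurs between the images of the blocks.
\<close>

locale blockwise_subst =
  fixes f :: "'a \<Rightarrow> ('a \<times> bool) list" and L H :: "'a set"
  assumes reduced_f [simp]: "reduced (f i)"
    and f_high: "i \<in> H \<Longrightarrow> f i = gen i"
    and disjoint: "L \<inter> H = {}"
    and low: "reduced w \<Longrightarrow> w \<noteq> [] \<Longrightarrow> fst ` set w \<subseteq> L \<Longrightarrow>
      word_eval (free_group UNIV) f w \<noteq> [] \<and>
      fst ` set (word_eval (free_group UNIV) f w) \<inter> H = {}"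
begin

abbreviation E :: "('a \<times> bool) list \<Rightarrow> ('a \<times> bool) list"
  where "E \<equiv> word_eval (free_group UNIV) f"

sublocale F: group "free_group (UNIV :: 'a set)" by simp

lemma E_append: "E (v @ w) = foldr push_letter (E v) (E w)"
  by (simp add: F.word_eval_append mult_free_group carrier_free_group image_subset_iff)

lemma reduced_E [simp]: "reduced (E w)"
  using F.word_eval_closed[of f w] by (simp add: carrier_free_group image_subset_iff)

lemma E_high_Cons: "fst l \<in> H \<Longrightarrow> E (l # w) = push_letter l (E w)"
  by (cases l)
    (auto simp: word_eval_Cons f_high inv_free_group mult_free_group,
     auto simp: gen_def letter_inv_def)

text \<open>The premise on \<open>s\<close> is what \<open>E_high\<close> supplies. Assuming it here
  makes the lemma available inside the induction that proves \<open>E_high\<close>.\<close>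

lemma E_low_append_aux:
  assumes "reduced m" "fst ` set m \<subseteq> L"
    and "s \<noteq> [] \<Longrightarrow> E s \<noteq> [] \<and> hd (E s) = hd s \<and> fst (hd s) \<in> H"
  shows "E (m @ s) = E m @ E s"
proof -
  have "reduced (E m @ E s)"
  proof (rule reduced_append_disjoint)
    assume ne: "E m \<noteq> []" "E s \<noteq> []"
    then have "m \<noteq> []" "s \<noteq> []" by auto
    with assms low[of m] ne have "fst (hd (E s)) \<in> H" "fst (last (E m)) \<notin> H"
      by (auto simp: disjoint_iff)
    then show "fst (hd (E s)) \<noteq> fst (last (E m))" by auto
  qed simp_all
  then show ?thesis by (simp add: E_append foldr_push_letter_append)
qed

text \<open>If nonempty, the image of \<open>w\<close> begins either with a fixed letter, where
  reducedness forbids cancellation with \<open>l\<close>, or with the image of an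
  \<open>L\<close>-block, which has no letter from \<open>H\<close>.\<close>

lemma E_high:
  assumes "reduced (l # w)" "fst l \<in> H" "fst ` set w \<subseteq> L \<union> H"
  shows "E (l # w) = l # E w"
  using assms
proof (induction "length w" arbitrary: l w rule: less_induct)
  case less
  \<comment> \<open>Cut \<open>w\<close> before its first letter from \<open>H\<close>, so that
    \<open>m\<close> is the leading \<open>L\<close>-block.\<close>
  define m s where "m = takeWhile (\<lambda>k. fst k \<notin> H) w" and "s = dropWhile (\<lambda>k. fst k \<notin> H) w"
  have w: "w = m @ s" by (simp add: m_def s_def)
  have "reduced m" using less.prems by (auto simp: w reduced_Cons reduced_append)
  moreover have "fst ` set m \<subseteq> L"
    using less.prems(3) set_takeWhileD[of _ "\<lambda>k. fst k \<notin> H" w] unfolding m_def by fastforce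
  ultimately have m: "fst ` set m \<subseteq> L" "reduced m" by auto
  have s: "fst (hd s) \<in> H" if "s \<noteq> []"
    using that hd_dropWhile unfolding s_def by blast
  have Es: "E s = hd s # E (tl s)" if "s \<noteq> []"
    using that s less.prems less.hyps[of "tl s" "hd s"]
    by (cases s) (auto simp: w reduced_Cons reduced_append)
  have Ew: "E w = E m @ E s"
    unfolding w using m s Es by (intro E_low_append_aux) auto
  have "E w = [] \<or> hd (E w) \<noteq> letter_inv l"
  proof (cases "m = []")
    case True
    with Ew Es less.prems show ?thesis by (cases s) (auto simp: w reduced_Cons)
  next
    case False
    with low[OF m(2)] m have "E m \<noteq> []" "fst (hd (E m)) \<notin> H"
      by (auto simp: disjoint_iff)
    then have "fst (hd (E w)) \<noteq> fst (letter_inv l)" using Ew less.prems by auto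
    then show ?thesis by metis
  qed
  then have "reduced (l # E w)" by (auto simp: reduced_Cons)
  with less.prems show ?case by (simp add: E_high_Cons push_letter_Cons)
qed

lemma E_low_append:
  assumes "reduced (m @ s)" "fst ` set m \<subseteq> L" "fst ` set s \<subseteq> L \<union> H"
    and "s \<noteq> [] \<Longrightarrow> fst (hd s) \<in> H"
  shows "E (m @ s) = E m @ E s"
proof (rule E_low_append_aux)
  show "E s \<noteq> [] \<and> hd (E s) = hd s \<and> fst (hd s) \<in> H" if "s \<noteq> []"
    using that assms E_high[of "hd s" "tl s"] by (cases s) (auto simp: reduced_append)
qed (use assms in \<open>auto simp: reduced_append\<close>)

lemma E_high_append:
  assumes "reduced (h @ w)" "fst ` set h \<subseteq> H" "fst ` set w \<subseteq> L \<union> H"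
  shows "E (h @ w) = h @ E w"
  using assms
proof (induction h)
  case (Cons l h)
  then show ?case using E_high[of l "h @ w"] by (auto simp: reduced_Cons)
qed simp

text \<open>\<open>E m\<close> has no letter from \<open>H\<close>, while \<open>E s\<close>, if
  nonempty, begins with one. Cutting both sides of the fixed-point equation before their first
  \<open>H\<close>-letter separates the two images.\<close>

lemma E_fixed_split:
  assumes "reduced (m @ s)" "fst ` set m \<subseteq> L" "fst ` set s \<subseteq> L \<union> H"
    and "s \<noteq> [] \<Longrightarrow> fst (hd s) \<in> H" and fixed: "E (m @ s) = m @ s"
  shows "E m = m" "E s = s"
proof -
  have eq: "E m @ E s = m @ s" using E_low_append assms by simp
  have Es: "E s = hd s # E (tl s)" if "s \<noteq> []"
    using that assms E_high[of "hd s" "tl s"] by (cases s) (auto simp: reduced_append)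
  have "fst ` set (E m) \<inter> H = {}"
    using assms low[of m] by (cases "m = []") (auto simp: reduced_append)
  then have "takeWhile (\<lambda>k. fst k \<notin> H) (E m @ E s) = E m"
    using Es assms(4) by (cases "s = []") (auto simp: takeWhile_append2 disjoint_iff)
  moreover have "takeWhile (\<lambda>k. fst k \<notin> H) (m @ s) = m"
  proof -
    have "takeWhile (\<lambda>k. fst k \<notin> H) s = []"
      using assms(4) by (cases s) auto
    moreover have "\<forall>k\<in>set m. fst k \<notin> H" using assms(2) disjoint by auto
    ultimately show ?thesis by (simp add: takeWhile_append2)
  qed
  ultimately show "E m = m" using eq by simp
  with eq show "E s = s" by simp
qed

text \<open>Single letters from \<open>H\<close> and whole \<open>L\<close>-blocks are peeled off
  the front, and each time the rest stays fixed.\<close>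

lemma E_fixed_suffix:
  assumes "reduced (p @ l # s)" "fst l \<in> H" "fst ` set (p @ l # s) \<subseteq> L \<union> H"
    and "E (p @ l # s) = p @ l # s"
  shows "E s = s"
  using assms
proof (induction "length p" arbitrary: p rule: less_induct)
  case less
  show ?case
  proof (cases p)
    case Nil
    with less.prems show ?thesis using E_high[of l s] by auto
  next
    case (Cons k p1)
    show ?thesis
    proof (cases "fst k \<in> H")
      case True
      with less.prems Cons have "E (p1 @ l # s) = p1 @ l # s"
        using E_high[of k "p1 @ l # s"] by auto
      with less.prems less.hyps[of p1] Cons show ?thesis by (auto simp: reduced_Cons)
    next
      case False
      define m t where "m = takeWhile (\<lambda>k. fst k \<notin> H) p" and "t = dropWhile (\<lambda>k. fst k \<notin> H) p"
      have p: "p = m @ t" by (simp add: m_def t_def)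
      have m: "fst ` set m \<subseteq> L"
        using less.prems(3) set_takeWhileD[of _ "\<lambda>k. fst k \<notin> H" p] unfolding m_def by fastforce
      have t: "fst (hd t) \<in> H" if "t \<noteq> []"
        using that hd_dropWhile unfolding t_def by blast
      have "E (t @ l # s) = t @ l # s"
        using less.prems m t
        by (intro E_fixed_split[of m "t @ l # s"]) (auto simp: p hd_append)
      moreover have "m \<noteq> []" using Cons False by (simp add: m_def)
      ultimately show ?thesis
        using less.prems less.hyps[of t] by (auto simp: p reduced_append)
    qed
  qed
qed

end

section \<open>Solutions of Wada's conditions\<close>

abbreviation FU :: "(nat \<times> bool) list monoid"
  where "FU \<equiv> free_group UNIV"

abbreviation shift :: "(nat \<times> bool) list \<Rightarrow> (nat \<times> bool) list"
  where "shift \<equiv> map (map_prod Suc id)"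

section \<open>Substitution into words in two generators, and renaming of generators\<close>

lemma subst2_closed:
  "group G \<Longrightarrow> a \<in> carrier G \<Longrightarrow> b \<in> carrier G \<Longrightarrow> subst2 G w a b \<in> carrier G"
  unfolding subst2_def by (rule group.word_eval_closed) auto

lemma hom_subst2:
  assumes "group G" "group H" "h \<in> hom G H" "a \<in> carrier G" "b \<in> carrier G"
  shows "h (subst2 G w a b) = subst2 H w (h a) (h b)"
proof -
  have "h (subst2 G w a b) = word_eval H (h \<circ> (\<lambda>i. if i = 0 then a else b)) w"
    unfolding subst2_def using assms by (intro hom_word_eval) auto
  also have "h \<circ> (\<lambda>i. if i = 0 then a else b) = (\<lambda>i. if i = 0 then h a else h b)"
    by (simp add: fun_eq_iff)
  finally show ?thesis by (simp only: subst2_def)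
qed

lemma subst2_in_hom:
  assumes "group G" "a \<in> carrier G" "b \<in> carrier G"
  shows "(\<lambda>w. subst2 G w a b) \<in> hom (free_group S) G"
  unfolding subst2_def using assms by (intro group.word_eval_hom) auto

lemma subst2_free_group_UNIV:
  assumes "a \<in> carrier (free_group S)" "b \<in> carrier (free_group S)"
  shows "subst2 (free_group S) w a b = subst2 (free_group UNIV) w a b"
  unfolding subst2_def using assms by (intro word_eval_free_group_UNIV) auto

lemma subst2_gen_0_1:
  assumes "w \<in> carrier F2"
  shows "subst2 FU w (gen 0) (gen 1) = w"
proof -
  have "subst2 FU w (gen 0) (gen 1) = word_eval FU gen w"
    unfolding subst2_def using assms by (intro word_eval_cong) (auto simp: carrier_free_group)
  with assms show ?thesis
    by (simp add: word_eval_gen carrier_free_group)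
qed

lemma subst2_gen:
  assumes "group G" "a \<in> carrier G" "b \<in> carrier G"
  shows "subst2 G (gen 0) a b = a" "subst2 G (gen (Suc 0)) a b = b"
  using assms group.is_monoid[OF assms(1)]
  by (auto simp: subst2_def gen_def word_eval_Cons monoid.r_one)

lemma letter_inv_map_prod: "letter_inv (map_prod f id l) = map_prod f id (letter_inv l)"
  by (simp add: letter_inv_def map_prod_def split: prod.split)

lemma reduced_map:
  assumes "inj f"
  shows "reduced (map (map_prod f id) w) \<longleftrightarrow> reduced w"
proof -
  have "map_prod f id l = map_prod f id m \<longleftrightarrow> l = m" for l m :: "'a \<times> bool"
    using assms by (cases l; cases m) (auto dest: injD)
  then show ?thesis
    by (simp add: reduced_iff_successively successively_map letter_inv_map_prod)
qed

lemma winv_map: "winv (map (map_prod f id) w) = map (map_prod f id) (winv w)"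
  by (simp add: winv_def rev_map letter_inv_map_prod)

text \<open>Either \<open>f i\<close> or its inverse is an \<open>n\<close>-th root of
  \<open>replicate n (i, b)\<close>, and such roots are unique.\<close>

lemma word_eval_replicate_fixed:
  assumes "\<And>i. reduced (f i)" "n \<noteq> 0"
    and "word_eval (free_group UNIV) f (replicate n (i, b)) = replicate n (i, b)"
  shows "f i = gen i"
proof -
  let ?g = "if b then f i else winv (f i)"
  have "f i \<in> carrier (free_group UNIV)" using assms(1) by (simp add: carrier_free_group)
  then have "?g [^]\<^bsub>free_group UNIV\<^esub> n = replicate n (i, b)"
    using assms(3) group.word_eval_replicate[OF group_free_group, of f i UNIV n b]
    by (cases b) (simp_all add: inv_free_group)
  moreover have "reduced ?g" using assms(1) by simp
  ultimately obtain k where "?g = replicate k (i, b)" "k * n = n"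
    using free_group_pow_eq_replicate[of ?g n n "(i, b)"] assms(2) by metis
  with assms(2) have g: "?g = [(i, b)]" by simp
  then have "f i = (if b then [(i, b)] else winv [(i, b)])"
    by (metis winv_simps(4))
  then show ?thesis by (simp add: gen_def letter_inv_def split: if_splits)
qed

lemma subseq_rev: "subseq xs ys \<Longrightarrow> subseq (rev xs) (rev ys)"
  by (induction rule: list_emb.induct) (auto intro: list_emb_append_mono subseq_rev_drop_many)

text \<open>The pattern may be spread out over \<open>w\<close>. At the last position where it can
  start, a 2 is followed directly by a run of 1's, and that run ends at another 2.\<close>

lemma subseq_block:
  assumes "fst ` set w \<subseteq> {1, 2 :: nat}" "subseq [2, 1, 2] (map fst w)"
  obtains r s m s' t where "w = r @ (2, s) # m @ (2, s') # t" "m \<noteq> []" "fst ` set m \<subseteq> {1}"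
proof -
  have "\<exists>r s m s' t. w = r @ (2, s) # m @ (2, s') # t \<and> m \<noteq> [] \<and> fst ` set m \<subseteq> {1}"
    using assms
  proof (induction w)
    case (Cons l w)
    show ?case
    proof (cases "subseq [2, 1, 2] (map fst w)")
      case True
      with Cons show ?thesis by (metis append_Cons insert_subset list.simps(15) image_insert)
    next
      case False
      with Cons.prems have l: "fst l = 2" and w: "subseq [1, 2] (map fst w)"
        by (auto split: if_splits)
      define m t where "m = takeWhile (\<lambda>k. fst k = 1) w" and "t = dropWhile (\<lambda>k. fst k = 1) w"
      have mt: "w = m @ t" by (simp add: m_def t_def)
      have m: "fst ` set m \<subseteq> {1}" by (auto simp: m_def dest: set_takeWhileD)
      \<comment> \<open>If the next letter were again 2, it could start the pattern inside the tail,
        contrary to the case assumption.\<close>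
      have "m \<noteq> []"
      proof
        assume "m = []"
        with w obtain k w' where "w = k # w'" "fst k \<noteq> 1"
          by (cases w) (auto simp: m_def split: if_splits)
        with Cons.prems w have "fst k = 2" "subseq [1, 2] (map fst w')" by auto
        with \<open>w = k # w'\<close> False show False by simp
      qed
      have "2 \<in> fst ` set w" using list_emb_set[OF w, of 2] by auto
      with m have "t \<noteq> []" by (auto simp: mt)
      then have "fst (hd t) \<noteq> 1" using hd_dropWhile unfolding t_def by blast
      with \<open>t \<noteq> []\<close> Cons.prems mt have "fst (hd t) = 2" by (cases t) auto
      then have "l # w = [] @ (2, snd l) # m @ (2, snd (hd t)) # tl t"
        using l mt \<open>t \<noteq> []\<close> by (cases l; cases t) auto
      with m \<open>m \<noteq> []\<close> show ?thesis by blast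
    qed
  qed simp
  with that show thesis by blast
qed

text \<open>
  The words p, q are the images of x, y under the inverse automorphism.
\<close>

locale wada_words =
  fixes u v p q :: "(nat \<times> bool) list"
  assumes F2: "u \<in> carrier F2" "v \<in> carrier F2" "p \<in> carrier F2" "q \<in> carrier F2"
    and wada1: "\<And>a b c. \<lbrakk>a \<in> carrier FU; b \<in> carrier FU; c \<in> carrier FU\<rbrakk> \<Longrightarrow>
      subst2 FU u (subst2 FU u a b) (subst2 FU u (subst2 FU v a b) c) =
      subst2 FU u a (subst2 FU u b c)"
    and wada2: "\<And>a b c. \<lbrakk>a \<in> carrier FU; b \<in> carrier FU; c \<in> carrier FU\<rbrakk> \<Longrightarrow>
      subst2 FU v (subst2 FU u a b) (subst2 FU u (subst2 FU v a b) c) =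
      subst2 FU u (subst2 FU v a (subst2 FU u b c)) (subst2 FU v b c)"
    and wada3: "\<And>a b c. \<lbrakk>a \<in> carrier FU; b \<in> carrier FU; c \<in> carrier FU\<rbrakk> \<Longrightarrow>
      subst2 FU v (subst2 FU v a b) c =
      subst2 FU v (subst2 FU v a (subst2 FU u b c)) (subst2 FU v b c)"
    and right_inverse1: "\<And>a b. \<lbrakk>a \<in> carrier FU; b \<in> carrier FU\<rbrakk> \<Longrightarrow>
      subst2 FU u (subst2 FU p a b) (subst2 FU q a b) = a"
    and right_inverse2: "\<And>a b. \<lbrakk>a \<in> carrier FU; b \<in> carrier FU\<rbrakk> \<Longrightarrow>
      subst2 FU v (subst2 FU p a b) (subst2 FU q a b) = b"
begin

sublocale F: group FU by simp

lemma carrier_FU [simp]: "w \<in> carrier FU \<longleftrightarrow> reduced w"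
  by (simp add: carrier_free_group)

lemma reduced_words [simp]: "reduced u" "reduced v" "reduced p" "reduced q"
  using F2 by (simp_all add: carrier_free_group)

lemma reduced_gen [simp]: "reduced (gen i)"
  by (simp add: gen_def reduced_Cons)

lemma reduced_subst2 [simp]: "reduced a \<Longrightarrow> reduced b \<Longrightarrow> reduced (subst2 FU w a b)"
  using subst2_closed[of FU a b w] by simp

lemma subst2_subst2:
  assumes "reduced a" "reduced b" "reduced c" "reduced d"
  shows "subst2 FU (subst2 FU w a b) c d = subst2 FU w (subst2 FU a c d) (subst2 FU b c d)"
  using hom_subst2[of FU FU "\<lambda>t. subst2 FU t c d" a b w] subst2_in_hom[of FU c d UNIV] assms
  by simp

lemma subst2_uv_pq:
  assumes "w \<in> carrier F2"
  shows "subst2 FU (subst2 FU w u v) p q = w"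
  using assms right_inverse1[of "gen 0" "gen 1"] right_inverse2[of "gen 0" "gen 1"] F2
    subst2_gen_0_1[of p] subst2_gen_0_1[of q] subst2_gen_0_1[of w]
  by (simp add: subst2_subst2)

lemma subst2_uv_inject:
  assumes "w \<in> carrier F2" "w' \<in> carrier F2" "subst2 FU w u v = subst2 FU w' u v"
  shows "w = w'"
  by (metis assms subst2_uv_pq)

text \<open>The inverse automorphism carries \<open>u\<close> to the generator x, which is not a
  proper power.\<close>

lemma u_not_power:
  assumes "reduced h" "h [^]\<^bsub>FU\<^esub> (n :: nat) = u"
  shows "n = 1"
proof -
  let ?h = "\<lambda>t. subst2 FU t p q"
  interpret h: group_hom FU FU ?h
    using subst2_in_hom[of FU p q UNIV] by (simp add: group_hom_def group_hom_axioms_def)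
  have "?h u = gen 0"
    using subst2_uv_pq[of "gen 0"] subst2_gen(1)[of FU u v] by simp
  then have "?h h [^]\<^bsub>FU\<^esub> n = replicate 1 (0, True)"
    using assms h.hom_nat_pow[of h n] by (simp add: gen_def)
  then obtain k where "k * n = 1"
    using free_group_pow_eq_replicate[of "?h h" n 1 "(0, True)"] assms(1) by fastforce
  then show ?thesis by simp
qed

text \<open>For u = x the second condition reads v(x, v) = v, so the automorphism sends v and y to
  the same word; injectivity finishes.\<close>

lemma trivial_u_imp_trivial_v:
  assumes "u = gen 0"
  shows "v = gen 1"
proof (rule subst2_uv_inject)
  have "subst2 FU v (gen 0) (subst2 FU v (gen 0) (gen 1)) = subst2 FU v (gen 0) (gen 1)"
    using wada2[of "gen 0" "gen 1" "gen 2"] assms subst2_gen(1)[of FU] by simp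
  then show "subst2 FU v u v = subst2 FU (gen 1) u v"
    using subst2_gen_0_1[of v] subst2_gen(2)[of FU u v] F2 assms by simp
qed (use F2 in auto)

text \<open>For v = y the second condition gives u = u(u, y), so the automorphism takes the same
  value on x and u.\<close>

lemma trivial_v_imp_trivial_u:
  assumes "v = gen 1"
  shows "u = gen 0"
proof (rule subst2_uv_inject)
  \<comment> \<open>With v = y the first variable drops out of the condition; x and y are put in
    place of the other two.\<close>
  have "subst2 FU u (gen 0) (gen 1) = subst2 FU u (subst2 FU u (gen 0) (gen 1)) (gen 1)"
    using wada2[of "gen 0" "gen 0" "gen 1"] assms subst2_gen(2)[of FU] by simp
  then show "subst2 FU u u v = subst2 FU (gen 0) u v"
    using subst2_gen_0_1[of u] subst2_gen(1)[of FU u v] F2 assms by simp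
qed (use F2 in auto)

definition phi :: "nat \<Rightarrow> (nat \<times> bool) list"
  where "phi i = (if i = 0 then u else if i = 1 then v else gen i)"

lemma word_eval_phi:
  assumes "fst ` set w \<subseteq> {0, 1}"
  shows "word_eval FU phi w = subst2 FU w u v"
  unfolding subst2_def using assms by (intro word_eval_cong) (auto simp: phi_def)

text \<open>Injectivity of the automorphism keeps images of nonempty words nonempty, and these
  images stay in the free factor on x and y.\<close>

sublocale Phi: blockwise_subst phi "{0, 1}" "- {0, 1}"
proof
  fix w :: "(nat \<times> bool) list"
  assume w: "reduced w" "w \<noteq> []" "fst ` set w \<subseteq> {0, 1}"
  have "subst2 FU w u v \<noteq> []"
  proof
    assume "subst2 FU w u v = []"
    with subst2_uv_pq[of w] w show False by (simp add: carrier_free_group subst2_def)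
  qed
  moreover have "subst2 FU w u v \<in> carrier F2"
    using subst2_closed[of F2 u v w] subst2_free_group_UNIV[OF F2(1,2), of w] F2 by simp
  ultimately show "word_eval FU phi w \<noteq> [] \<and> fst ` set (word_eval FU phi w) \<inter> - {0, 1} = {}"
    using w by (auto simp: word_eval_phi carrier_free_group)
qed (auto simp: phi_def)

section \<open>The fixed word \<open>T\<close> and the shape of \<open>u\<close>\<close>

definition T :: "(nat \<times> bool) list"
  where "T = subst2 FU u (gen 0) (subst2 FU u (gen 1) (gen 2))"

text \<open>Applied to \<open>T\<close>, the automorphism gives the left side of the first
  condition, whose right side is \<open>T\<close>.\<close>

lemma Phi_T: "Phi.E T = T"
proof -
  have hom: "Phi.E \<in> hom FU FU"
    by (rule F.word_eval_hom) (auto simp: phi_def)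
  have gens: "Phi.E (gen 0) = u" "Phi.E (gen 1) = v" "Phi.E (gen 2) = gen 2"
    by (simp_all add: gen_def[of 0] gen_def[of "Suc 0"] gen_def[of 2] word_eval_Cons phi_def)
      (simp_all add: gen_def mult_free_group)
  have "Phi.E T = subst2 FU u u (subst2 FU u v (gen 2))"
    unfolding T_def using gens by (simp add: hom_subst2[OF _ _ hom])
  also have "\<dots> = T"
    using wada1[of "gen 0" "gen 1" "gen 2"] F2 subst2_gen_0_1[of u] subst2_gen_0_1[of v]
    by (simp add: T_def)
  finally show ?thesis .
qed

text \<open>Renaming x, y to y, z makes this the word u(y, z), reduced as it stands.\<close>

definition w :: "(nat \<times> bool) list"
  where "w = shift u"

lemma subst2_u_1_2: "subst2 FU u (gen 1) (gen 2) = w"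
proof -
  have "subst2 FU u (gen 1) (gen 2) = word_eval FU (gen \<circ> Suc) u"
    unfolding subst2_def using F2
    by (intro word_eval_cong) (auto simp: carrier_free_group numeral_2_eq_2)
  also have "\<dots> = w"
    unfolding w_def word_eval_map[symmetric]
    by (intro word_eval_gen) (simp add: reduced_map)
  finally show ?thesis .
qed

lemma u_ne_Nil: "u \<noteq> []"
  using subst2_uv_inject[of "[]" "gen 0"] subst2_gen(1)[of FU u v]
  by (auto simp: subst2_def carrier_free_group gen_def reduced_Cons)

lemma w_props: "reduced w" "fst ` set w \<subseteq> {1, 2}" "w \<noteq> []"
proof -
  show "reduced w" by (simp add: w_def reduced_map)
  show "fst ` set w \<subseteq> {1, 2}"
    using F2(1) by (force simp: w_def carrier_free_group)
  show "w \<noteq> []" using u_ne_Nil by (simp add: w_def)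
qed

text \<open>Chosen so that \<open>T\<close> arises from \<open>u\<close> by this substitution, see
  \<open>Theta_u\<close>.\<close>

definition theta :: "nat \<Rightarrow> (nat \<times> bool) list"
  where "theta i = (if i = 1 then w else gen i)"

lemma word_eval_theta_replicate:
  "word_eval FU theta (replicate n (1, b)) = (if b then w else winv w) [^]\<^bsub>FU\<^esub> n"
  using F.word_eval_replicate[of theta 1 n b] w_props(1) inv_free_group[of w UNIV]
  by (simp add: theta_def)

text \<open>Here x is the fixed letter and the blocks are powers of y. Torsion-freeness keeps their
  images nonempty, and these contain only y and z.\<close>

sublocale Theta: blockwise_subst theta "{1}" "{0}"
proof
  fix t :: "(nat \<times> bool) list"
  assume t: "reduced t" "t \<noteq> []" "fst ` set t \<subseteq> {1}"
  then obtain n b where n: "t = replicate n (1, b)" "n \<noteq> 0"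
    by (metis reduced_one_generator replicate_0)
  have "word_eval FU theta t \<noteq> []"
    unfolding n word_eval_theta_replicate
    using w_props n by (intro free_group_pow_ne_Nil) auto
  moreover have "word_eval (free_group {1, 2}) theta t \<in> carrier (free_group {1, 2})"
    using t w_props by (intro group.word_eval_closed) (auto simp: theta_def carrier_free_group)
  moreover have "word_eval (free_group {1, 2}) theta t = word_eval FU theta t"
    using t w_props by (intro word_eval_free_group_UNIV) (auto simp: theta_def carrier_free_group)
  ultimately show "word_eval FU theta t \<noteq> [] \<and> fst ` set (word_eval FU theta t) \<inter> {0} = {}"
    by (auto simp: carrier_free_group)
qed (use w_props in \<open>auto simp: theta_def\<close>)

lemma Theta_u: "Theta.E u = T"
proof -
  have "T = subst2 FU u (gen 0) w" by (simp only: T_def subst2_u_1_2)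
  also have "\<dots> = Theta.E u"
    unfolding subst2_def using F2(1)
    by (intro word_eval_cong) (auto simp: theta_def carrier_free_group)
  finally show ?thesis by simp
qed

text \<open>Since \<open>w'\<close> contains no x, some two occurrences of z in it enclose a
  nontrivial power of y. The automorphism acts on this block separately and fixes it, so uniqueness
  of roots applies.\<close>

lemma v_trivial_of_pattern:
  assumes "T = r @ w' @ s" "fst ` set w' \<subseteq> {1, 2}" "subseq [2, 1, 2] (map fst w')"
  shows "v = gen 1"
proof -
  obtain r' e m e' s' where w': "w' = r' @ (2, e) # m @ (2, e') # s'"
    and m: "m \<noteq> []" "fst ` set m \<subseteq> {1}"
    using subseq_block[OF assms(2,3)] .
  have T: "T = (r @ r') @ (2, e) # (m @ (2, e') # s' @ s)" by (simp add: assms(1) w')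
  have redT: "reduced T" by (simp add: T_def)
  \<comment> \<open>Everything up to the left z is dropped first; then the block is split off before
    the right z.\<close>
  have "Phi.E (m @ (2, e') # s' @ s) = m @ (2, e') # s' @ s"
    using Phi_T redT unfolding T by - (rule Phi.E_fixed_suffix[of "r @ r'" "(2, e)"], auto)
  then have "Phi.E m = m"
    using redT m unfolding T
    by (intro Phi.E_fixed_split(1)[of m "(2, e') # s' @ s"]) (auto simp: reduced_append reduced_Cons)
  moreover have "reduced m" using redT by (auto simp: T reduced_append reduced_Cons)
  then obtain n b where n: "m = replicate n (1, b)" using reduced_one_generator m(2) by metis
  moreover have "n \<noteq> 0" using m(1) n by auto
  ultimately have "phi 1 = gen 1"
    using word_eval_replicate_fixed[where f = phi and n = n and i = 1 and b = b] Phi.reduced_f by simp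
  then show ?thesis by (simp add: phi_def)
qed

text \<open>Let u = r m s with m the first run of y. Acting by blocks, \<open>theta\<close> gives T
  = r W theta(s), where W is a power of u(y, z) or of its inverse. A further y in u would create the
  pattern z, y, z inside W, or else make u a proper power.\<close>

lemma u_shape:
  "(u = gen 0 \<and> v = gen 1) \<or>
   (\<exists>r b s. u = r @ [(1, b)] @ s \<and> fst ` set r \<subseteq> {0} \<and> fst ` set s \<subseteq> {0})"
proof -
  define r t where "r = takeWhile (\<lambda>l. fst l = 0) u" and "t = dropWhile (\<lambda>l. fst l = 0) u"
  have u_rt: "u = r @ t" by (simp add: r_def t_def)
  have r: "fst ` set r \<subseteq> {0}" by (auto simp: r_def dest: set_takeWhileD)
  have letters: "fst ` set u \<subseteq> {0, 1}" using F2(1) by (simp add: carrier_free_group)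
  show ?thesis
  proof (cases "t = []")
    case True
    then have "u = r" by (simp add: u_rt)
    with r have u0: "fst ` set u \<subseteq> {0}" by simp
    then obtain n b where u: "u = replicate n (0, b)"
      using reduced_one_generator[OF reduced_words(1)] by metis
    \<comment> \<open>A word without y is untouched by \<open>theta\<close>, hence
      \<open>T = u\<close>.\<close>
    have "Theta.E (u @ []) = u @ Theta.E []"
      using u0 by (intro Theta.E_high_append) auto
    then have "T = u" by (simp add: Theta_u)
    with Phi_T have "Phi.E u = u" by simp
    have "n \<noteq> 0"
      using u u_ne_Nil by (metis replicate_0)
    have "phi 0 = gen 0"
    proof (rule word_eval_replicate_fixed[OF Phi.reduced_f \<open>n \<noteq> 0\<close>])
      show "Phi.E (replicate n (0, b)) = replicate n (0, b)"
        using \<open>Phi.E u = u\<close> by (simp only: u[symmetric])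
    qed
    then show ?thesis using trivial_u_imp_trivial_v by (simp add: phi_def)
  next
    case False
    define m s where "m = takeWhile (\<lambda>l. fst l = 1) t" and "s = dropWhile (\<lambda>l. fst l = 1) t"
    have t_ms: "t = m @ s" by (simp add: m_def s_def)
    have m: "fst ` set m \<subseteq> {1}" by (auto simp: m_def dest: set_takeWhileD)
    have "fst (hd t) \<noteq> 0" using False hd_dropWhile unfolding t_def by blast
    then have "fst (hd t) = 1" using letters False by (cases t) (auto simp: u_rt)
    then have "m \<noteq> []" using False by (cases t) (auto simp: m_def)
    have red: "reduced (r @ m @ s)" using reduced_words(1) by (simp add: u_rt t_ms)
    then have "reduced m" by (simp add: reduced_append)
    then obtain n b where m_eq: "m = replicate n (1, b)"
      using reduced_one_generator m by metis
    have "n \<noteq> 0" using \<open>m \<noteq> []\<close> m_eq by auto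
    have s: "fst (hd s) = 0" if "s \<noteq> []"
    proof -
      have "fst (hd s) \<noteq> 1" using that hd_dropWhile unfolding s_def by blast
      then show ?thesis using letters that by (cases s) (auto simp: u_rt t_ms)
    qed
    \<comment> \<open>The sign of the run \<open>m\<close> is absorbed into \<open>w'\<close>, so
      that a power with natural exponent is the image of \<open>m\<close>.\<close>
    define w' where "w' = (if b then w else winv w)"
    have w': "reduced w'" "fst ` set w' \<subseteq> {1, 2}" using w_props by (auto simp: w'_def)
    define W where "W = w' [^]\<^bsub>FU\<^esub> n"
    have u_eq: "u = r @ m @ s" by (simp only: u_rt t_ms)
    have ms: "fst ` set (m @ s) \<subseteq> {1} \<union> {0}" using letters unfolding u_eq by auto
    have "T = Theta.E (r @ m @ s)" unfolding u_eq[symmetric] by (rule Theta_u[symmetric])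
    also have "\<dots> = r @ Theta.E (m @ s)"
      using red r ms by (intro Theta.E_high_append) auto
    also have "Theta.E (m @ s) = Theta.E m @ Theta.E s"
      using red m s ms by (intro Theta.E_low_append) (auto simp: reduced_append)
    finally have T: "T = r @ W @ Theta.E s"
      unfolding m_eq word_eval_theta_replicate W_def w'_def .
    have "w' \<in> carrier (free_group {1, 2})" using w' by (simp add: carrier_free_group)
    then have "w' [^]\<^bsub>free_group {1, 2}\<^esub> n \<in> carrier (free_group {1, 2})"
      by (simp add: monoid.nat_pow_closed group.is_monoid)
    moreover have "w' [^]\<^bsub>free_group {1, 2}\<^esub> n = W"
      unfolding W_def by (induction n) (simp_all add: mult_free_group)
    ultimately have "fst ` set W \<subseteq> {1, 2}" by (simp add: carrier_free_group)
    then have *: ?thesis if "subseq [2, 1, 2] (map fst W)"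
      using v_trivial_of_pattern[OF T _ that] trivial_v_imp_trivial_u by blast
    \<comment> \<open>It suffices to find the pattern in a lower power of \<open>w'\<close>;
      exponents 1 and 2 are used below.\<close>
    have lift: "subseq [2, 1, 2] (map fst W)"
      if "subseq [2, 1, 2] (map fst (w' [^]\<^bsub>FU\<^esub> k))" "0 < k" "k \<le> n" for k
      using that subseq_free_group_pow[OF w'(1) that(2,3)] unfolding W_def
      by (meson subseq_map subseq_order.order_trans)
    consider "1 \<in> fst ` set s" | "1 \<notin> fst ` set s" "n = 1" | "1 \<notin> fst ` set s" "2 \<le> n"
      using \<open>n \<noteq> 0\<close> by linarith
    moreover have s_letters: "fst ` set s \<subseteq> {0, 1}" using ms by auto
    ultimately show ?thesis
    proof cases
      case 1
      then obtain l s' where "s = l # s'" by (cases s) auto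
      with 1 s have "subseq [1] (map fst s')" "fst l = 0"
        by (auto simp: subseq_singleton_left)
      \<comment> \<open>The run \<open>m\<close> supplies a y, the first letter of \<open>s\<close>
        an x, and the rest of \<open>s\<close> another y. Renaming turns this into z, y, z inside
        \<open>w\<close>.\<close>
      then have "subseq ([1] @ [0, 1]) (map fst m @ map fst s)"
        using \<open>s = l # s'\<close> m_eq \<open>n \<noteq> 0\<close>
        by (intro list_emb_append_mono) (auto simp: subseq_singleton_left)
      then have "subseq [1, 0, 1] (map fst u)"
        by (simp add: u_eq list_emb_append2)
      then have "subseq (map Suc [1, 0, 1]) (map Suc (map fst u))" by (rule subseq_map)
      then have "subseq [2, 1, 2] (map fst w)" by (simp add: w_def numeral_2_eq_2 o_def)
      \<comment> \<open>The pattern is a palindrome, so it is also present when \<open>w'\<close> is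
        the inverse of \<open>w\<close>.\<close>
      then have "subseq [2, 1, 2] (map fst w')"
        using subseq_rev[of "[2, 1, 2]" "map fst w"] by (simp add: w'_def)
      moreover have "w' [^]\<^bsub>FU\<^esub> (1 :: nat) = w'" using w' by simp
      ultimately show ?thesis using \<open>n \<noteq> 0\<close> lift[of 1] by (intro *) simp
    next
      case 2
      have "fst ` set s \<subseteq> {0}" using s_letters 2(1) by (simp add: insert_commute[of 0] subset_insert)
      moreover have "u = r @ [(1, b)] @ s"
        using u_eq m_eq 2(2) by (simp only: replicate_Suc replicate_0 One_nat_def)
      ultimately show ?thesis using r by blast
    next
      case 3
      text \<open>
        Now u = r y^{\<plusminus>n} s. The square of w' contains the block d = s' r' between two
        powers of z; if d is trivial, then u is the n-th power of r y^{\<plusminus>1} r^{-1}.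
      \<close>
      have s0: "fst ` set s \<subseteq> {0}" using s_letters 3(1) by (simp add: insert_commute[of 0] subset_insert)
      \<comment> \<open>If \<open>b\<close> is false, inverting \<open>w\<close> reverses the order
        and flips the signs: the outer pieces change places, and z occurs with positive sign in both
        cases.\<close>
      define r' where "r' = (if b then shift r else winv (shift s))"
      define s' where "s' = (if b then shift s else winv (shift r))"
      have "m \<noteq> []" "reduced r" "reduced s" using red by (simp_all add: reduced_append m_eq \<open>n \<noteq> 0\<close>)
      moreover have "fst ` set (shift t) \<subseteq> {1}" if "fst ` set t \<subseteq> {0}" for t :: "(nat \<times> bool) list"
        using that by force
      ultimately have rs': "reduced r'" "reduced s'" "fst ` set r' \<subseteq> {1}" "fst ` set s' \<subseteq> {1}"
        using r s0 by (simp_all add: r'_def s'_def reduced_map)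
      define z where "z = replicate n (2 :: nat, True)"
      have z: "z \<noteq> []" "reduced z" "fst ` set z = {2}" using \<open>n \<noteq> 0\<close> by (auto simp: z_def)
      have w'_eq: "w' = r' @ z @ s'"
      proof -
        have "w = shift r @ shift m @ shift s" unfolding w_def by (simp add: u_eq)
        then show ?thesis
          by (simp add: w'_def m_eq r'_def s'_def z_def winv_replicate)
      qed
      define d where "d = foldr push_letter s' r'"
      have d: "reduced d" "fst ` set d \<subseteq> {1}"
        using rs' set_foldr_push_letter[of s' r'] by (fastforce simp: d_def reduced_foldr_push_letter)+
      show ?thesis
      proof (cases "d = []")
        case True
        then have "s' \<otimes>\<^bsub>FU\<^esub> r' = \<one>\<^bsub>FU\<^esub>" by (simp add: d_def mult_free_group)
        then have "s' = winv r'"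
          using rs' F.inv_equality[of s' r'] by (simp add: inv_free_group)
        then have "shift s = shift (winv r)"
          by (cases b) (auto simp: r'_def s'_def winv_map)
        then have "s = winv r"
          by (rule map_injective) (auto intro: prod.inj_map)
        \<comment> \<open>The run is written as copies of a one-letter core, to match
          \<open>free_group_pow_conjugate\<close>.\<close>
        then have "r @ concat (replicate n [(1, b)]) @ winv r = u"
          by (simp add: u_eq m_eq)
        moreover have "fst (last r) = 0" "fst (hd (winv r)) = 0" if "r \<noteq> []"
          using that r last_in_set[of r] s \<open>s = winv r\<close> by (auto simp: image_subset_iff)
        then have "reduced (r @ [(1, b)] @ winv r)"
          using \<open>reduced r\<close>
          by (intro reduced_append_disjoint) (auto simp: reduced_Cons letter_inv_def)
        ultimately have "(r @ [(1, b)] @ winv r) [^]\<^bsub>FU\<^esub> n = u" "reduced (r @ [(1, b)] @ winv r)"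
          using free_group_pow_conjugate[of r "[(1, b)]" n] \<open>n \<noteq> 0\<close>
          by (simp_all add: reduced_Cons letter_inv_def)
        then have "n = 1" using u_not_power by blast
        with 3 show ?thesis by simp
      next
        case False
        have z_ends: "fst (hd z) = 2" "fst (last z) = 2" using \<open>n \<noteq> 0\<close> by (simp_all add: z_def)
        have one: "fst (hd t) = 1" "fst (last t) = 1"
          if "t \<noteq> []" "fst ` set t \<subseteq> {1}" for t :: "(nat \<times> bool) list"
          using that hd_in_set[of t] last_in_set[of t] by (simp_all add: image_subset_iff)
        have red_zs: "reduced (z @ s')"
          using z z_ends rs' one[of s'] by - (rule reduced_append_disjoint, simp_all)
        then have red_dzs: "reduced (d @ z @ s')"
          using d z z_ends one[of d] by - (rule reduced_append_disjoint, simp_all)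
        have "w' [^]\<^bsub>FU\<^esub> (2 :: nat) = foldr push_letter (r' @ z) (foldr push_letter s' (r' @ z @ s'))"
          using w' by (simp add: numeral_2_eq_2 mult_free_group foldr_push_letter_Nil)
            (simp add: w'_eq)
        \<comment> \<open>Only the inner \<open>s'\<close> and \<open>r'\<close> can cancel; they
          collapse to \<open>d\<close>.\<close>
        also have "foldr push_letter s' (r' @ z @ s') = d @ z @ s'"
          using foldr_push_letter_assoc[OF red_zs, of s' r'] w'(1)
            foldr_push_letter_append[OF red_dzs] foldr_push_letter_append[of r' "z @ s'"]
          by (simp add: d_def w'_eq)
        also have "foldr push_letter (r' @ z) (d @ z @ s') = r' @ z @ d @ z @ s'"
        proof -
          have "reduced (z @ d @ z @ s')"
            using red_dzs False d z z_ends one[of d] by - (rule reduced_append_disjoint, simp_all)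
          then have "reduced (r' @ z @ d @ z @ s')"
            using rs' z z_ends one[of r'] by - (rule reduced_append_disjoint, simp_all)
          then show ?thesis using foldr_push_letter_append[of "r' @ z" "d @ z @ s'"] by simp
        qed
        finally have "w' [^]\<^bsub>FU\<^esub> (2 :: nat) = r' @ z @ d @ z @ s'" .
        moreover have "subseq ([] @ [2] @ [1] @ [2] @ []) (map fst (r' @ z @ d @ z @ s'))"
          unfolding map_append using z one(1)[OF False d(2)] imageI[OF hd_in_set[OF False], of fst]
          by (intro list_emb_append_mono) (auto simp: subseq_singleton_left)
        ultimately show ?thesis
          using 3 lift[of 2] by (intro *) simp
      qed
    qed
  qed
qed

end

section \<open>The symmetry exchanging u(x, y) with v(y, x)\<close>

abbreviation mirror :: "(nat \<times> bool) list \<Rightarrow> (nat \<times> bool) list"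
  where "mirror \<equiv> map (map_prod (id(0 := 1, 1 := 0)) id)"

lemma mirror_in_F2: "w \<in> carrier F2 \<Longrightarrow> mirror w \<in> carrier F2"
  by (auto simp: carrier_free_group reduced_map inj_def)

lemma mirror_mirror: "mirror (mirror w) = w"
  by (induction w) (auto simp: map_prod_def split: prod.split)

lemma subst2_mirror:
  assumes "w \<in> carrier F2"
  shows "subst2 G (mirror w) a b = subst2 G w b a"
  unfolding subst2_def word_eval_map using assms
  by (intro word_eval_cong) (auto simp: carrier_free_group)

context wada_words
begin

text \<open>Reading the variables in reverse order interchanges the first and third conditions and
  turns the second into itself. The inverse words are exchanged in the same way.\<close>

lemma wada_words_mirror: "wada_words (mirror v) (mirror u) (mirror q) (mirror p)"
proof
  show "subst2 FU (mirror v) (subst2 FU (mirror v) a b) (subst2 FU (mirror v) (subst2 FU (mirror u) a b) c) =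
    subst2 FU (mirror v) a (subst2 FU (mirror v) b c)"
    if "a \<in> carrier FU" "b \<in> carrier FU" "c \<in> carrier FU" for a b c
    using wada3[of c b a] that by (simp only: subst2_mirror F2)
  show "subst2 FU (mirror u) (subst2 FU (mirror v) a b) (subst2 FU (mirror v) (subst2 FU (mirror u) a b) c) =
    subst2 FU (mirror v) (subst2 FU (mirror u) a (subst2 FU (mirror v) b c)) (subst2 FU (mirror u) b c)"
    if "a \<in> carrier FU" "b \<in> carrier FU" "c \<in> carrier FU" for a b c
    using wada2[of c b a] that by (simp only: subst2_mirror F2)
  show "subst2 FU (mirror u) (subst2 FU (mirror u) a b) c =
    subst2 FU (mirror u) (subst2 FU (mirror u) a (subst2 FU (mirror v) b c)) (subst2 FU (mirror u) b c)"
    if "a \<in> carrier FU" "b \<in> carrier FU" "c \<in> carrier FU" for a b c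
    using wada1[of c b a] that by (simp only: subst2_mirror F2)
  show "subst2 FU (mirror v) (subst2 FU (mirror q) a b) (subst2 FU (mirror p) a b) = a"
    if "a \<in> carrier FU" "b \<in> carrier FU" for a b
    using right_inverse2[of b a] that by (simp only: subst2_mirror F2)
  show "subst2 FU (mirror u) (subst2 FU (mirror q) a b) (subst2 FU (mirror p) a b) = b"
    if "a \<in> carrier FU" "b \<in> carrier FU" for a b
    using right_inverse1[of b a] that by (simp only: subst2_mirror F2)
qed (simp_all only: mirror_in_F2 F2)

lemma v_shape:
  "(u = gen 0 \<and> v = gen 1) \<or>
   (\<exists>r b s. v = r @ [(0, b)] @ s \<and> fst ` set r \<subseteq> {1} \<and> fst ` set s \<subseteq> {1})"
proof -
  consider "mirror v = gen 0" "mirror u = gen 1"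
    | r b s where "mirror v = r @ [(1, b)] @ s" "fst ` set r \<subseteq> {0}" "fst ` set s \<subseteq> {0}"
    using wada_words.u_shape[OF wada_words_mirror] by auto
  then show ?thesis
  proof cases
    case 1
    then have "mirror (mirror v) = mirror (gen 0)" "mirror (mirror u) = mirror (gen 1)"
      by simp_all
    then show ?thesis unfolding mirror_mirror by (simp add: gen_def)
  next
    case 2
    have "v = mirror r @ [(0, b)] @ mirror s"
      using arg_cong[OF 2(1), of mirror] unfolding mirror_mirror by simp
    moreover have "fst ` set (mirror r) \<subseteq> {1}" "fst ` set (mirror s) \<subseteq> {1}"
      using 2(2,3) by force+
    ultimately show ?thesis by blast
  qed
qed

end

section \<open>Transport to arbitrary groups and the birack axioms\<close>

lemma wada_conditions_in_group:
  assumes G: "group G" and uv: "wada_conditions u v"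
    and abc: "a \<in> carrier G" "b \<in> carrier G" "c \<in> carrier G"
  defines "U \<equiv> subst2 G u" and "V \<equiv> subst2 G v"
  shows "U (U a b) (U (V a b) c) = U a (U b c)"
    and "V (U a b) (U (V a b) c) = U (V a (U b c)) (V b c)"
    and "V (V a b) c = V (V a (U b c)) (V b c)"
proof -
  interpret G: group G by fact
  \<comment> \<open>The homomorphism sending x, y, z to a, b, c carries the identities from
    \<open>F3\<close> to \<open>G\<close>.\<close>
  define h where "h = word_eval G (\<lambda>i :: nat. if i = 0 then a else if i = 1 then b else c)"
  have h: "h \<in> hom F3 G"
    unfolding h_def using abc by (intro G.word_eval_hom) auto
  have gens: "h (gen 0) = a" "h (gen 1) = b" "h (gen 2) = c"
    using abc by (auto simp: h_def gen_def word_eval_Cons)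
  have hs: "h (subst2 F3 t r s) = subst2 G t (h r) (h s)"
    if "r \<in> carrier F3" "s \<in> carrier F3" for t r s
    using that by (intro hom_subst2[OF _ G h]) auto
  note wada = uv[unfolded wada_conditions_def Let_def]
  have F3: "subst2 F3 t r s \<in> carrier F3" if "r \<in> carrier F3" "s \<in> carrier F3" for t r s
    using that by (intro subst2_closed) auto
  have "gen 0 \<in> carrier F3" "gen 1 \<in> carrier F3" "gen 2 \<in> carrier F3" by simp_all
  note simps = hs F3 gens this
  show "U (U a b) (U (V a b) c) = U a (U b c)"
    using arg_cong[OF wada[THEN conjunct1], of h] by (simp only: simps U_def V_def)
  show "V (U a b) (U (V a b) c) = U (V a (U b c)) (V b c)"
    using arg_cong[OF wada[THEN conjunct2, THEN conjunct1], of h] by (simp only: simps U_def V_def)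
  show "V (V a b) c = V (V a (U b c)) (V b c)"
    using arg_cong[OF wada[THEN conjunct2, THEN conjunct2], of h] by (simp only: simps U_def V_def)
qed

lemma subst2_subst2_F2:
  assumes "group G" "s \<in> carrier F2" "t \<in> carrier F2" "a \<in> carrier G" "b \<in> carrier G"
  shows "subst2 G (subst2 F2 w s t) a b = subst2 G w (subst2 G s a b) (subst2 G t a b)"
  using hom_subst2[OF group_free_group assms(1) subst2_in_hom assms(2,3)] assms by simp

text \<open>Take \<open>p\<close> and \<open>q\<close> to be preimages of x and y. The automorphism
  maps u(p, q) to u, which is also the image of x, so injectivity gives u(p, q) = x; similarly for
  v.\<close>

lemma automorphism_inverse_words:
  assumes u: "u \<in> carrier F2" and v: "v \<in> carrier F2" and uv: "defines_automorphism u v"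
  obtains p q where "p \<in> carrier F2" "q \<in> carrier F2"
    "subst2 F2 p u v = gen 0" "subst2 F2 q u v = gen 1"
    "subst2 F2 u p q = gen 0" "subst2 F2 v p q = gen 1"
proof -
  let ?f = "\<lambda>w. subst2 F2 w u v"
  have bij: "bij_betw ?f (carrier F2) (carrier F2)"
    using uv by (simp add: defines_automorphism_def iso_def)
  then have "gen 0 \<in> ?f ` carrier F2" "gen 1 \<in> ?f ` carrier F2"
    by (simp_all only: bij_betw_imp_surj_on gen_in_free_group insertI1 insertI2)
  then obtain p q where p: "p \<in> carrier F2" "?f p = gen 0" and q: "q \<in> carrier F2" "?f q = gen 1"
    by (elim imageE) metis
  have F2: "subst2 F2 w p q \<in> carrier F2" for w
    using p q by (intro subst2_closed) auto
  have f: "?f (subst2 F2 w p q) = w" if "w \<in> carrier F2" for w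
  proof -
    have "?f (subst2 F2 w p q) = subst2 F2 w (gen 0) (gen 1)"
      using subst2_subst2_F2[OF group_free_group p(1) q(1) u v, of w] by (simp only: p(2) q(2))
    also have "\<dots> = w"
      using subst2_gen_0_1[OF that] by (subst subst2_free_group_UNIV) simp_all
    finally show ?thesis .
  qed
  note inj = inj_onD[OF bij_betw_imp_inj_on[OF bij]]
  have "subst2 F2 u p q = gen 0"
    by (rule inj) (use f[OF u] subst2_gen(1)[OF group_free_group u v] F2 in simp_all)
  moreover have "subst2 F2 v p q = gen 1"
    by (rule inj) (use f[OF v] subst2_gen(2)[OF group_free_group u v] F2 in simp_all)
  ultimately show thesis by (rule that[OF p(1) q(1) p(2) q(2)])
qed

text \<open>A letter that occurs only once can be isolated by cancelling the values of the words on
  its two sides.\<close>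

lemma (in group) unique_solution_word:
  assumes "i \<notin> fst ` set r" "i \<notin> fst ` set s" "\<And>j. \<rho> j \<in> carrier G" "d \<in> carrier G"
  shows "\<exists>!y. y \<in> carrier G \<and> word_eval G (\<rho>(i := y)) (r @ [(i, b)] @ s) = d"
proof -
  define \<alpha> \<beta> where "\<alpha> = word_eval G \<rho> r" and "\<beta> = word_eval G \<rho> s"
  have \<alpha>\<beta>: "\<alpha> \<in> carrier G" "\<beta> \<in> carrier G"
    unfolding \<alpha>_def \<beta>_def using assms by (auto intro!: word_eval_closed)
  have eval: "word_eval G (\<rho>(i := y)) (r @ [(i, b)] @ s) =
      \<alpha> \<otimes> ((if b then y else inv y) \<otimes> \<beta>)" if "y \<in> carrier G" for y
  proof -
    have "word_eval G (\<rho>(i := y)) r = \<alpha>" "word_eval G (\<rho>(i := y)) s = \<beta>"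
      unfolding \<alpha>_def \<beta>_def
      by (rule word_eval_cong, rule fun_upd_other, use assms(1,2) in blast)+
    moreover have "word_eval G (\<rho>(i := y)) (r @ [(i, b)] @ s) =
      word_eval G (\<rho>(i := y)) r \<otimes> word_eval G (\<rho>(i := y)) ([(i, b)] @ s)"
      using that assms(3) by (intro word_eval_append) auto
    ultimately show ?thesis by (simp add: word_eval_Cons)
  qed
  have key: "\<alpha> \<otimes> (x \<otimes> \<beta>) = d \<longleftrightarrow> x = inv \<alpha> \<otimes> d \<otimes> inv \<beta>" if "x \<in> carrier G" for x
    using that \<alpha>\<beta> assms(4) by (metis inv_solve_left inv_solve_right m_assoc m_closed inv_closed)
  define e where "e = inv \<alpha> \<otimes> d \<otimes> inv \<beta>"
  have e: "e \<in> carrier G" using \<alpha>\<beta> assms(4) by (simp add: e_def)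
  show ?thesis
  proof (rule ex1I[of _ "if b then e else inv e"])
    show "(if b then e else inv e) \<in> carrier G \<and>
      word_eval G (\<rho>(i := if b then e else inv e)) (r @ [(i, b)] @ s) = d"
      using e eval[of "if b then e else inv e"] key[of e] by (simp add: e_def[symmetric])
  next
    fix y assume y: "y \<in> carrier G \<and> word_eval G (\<rho>(i := y)) (r @ [(i, b)] @ s) = d"
    then have "(if b then y else inv y) = e"
      unfolding e_def by (intro key[THEN iffD1]) (simp_all add: eval[symmetric])
    with y show "y = (if b then e else inv e)" by (auto split: if_splits)
  qed
qed

text \<open>The words \<open>p\<close>, \<open>q\<close> give the inverse of the map in every group,
  and the single occurrences of y in u and of x in v give the two unique-solution axioms.\<close>

lemma birack_wada:
  assumes G: "group G" and u: "u \<in> carrier F2" and v: "v \<in> carrier F2"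
    and aut: "defines_automorphism u v" and wada: "wada_conditions u v"
    and nontriv: "\<not> (u = gen 0 \<and> v = gen 1)"
  shows "birack (carrier G) (\<lambda>(x, y). (subst2 G u x y, subst2 G v x y))"
proof -
  interpret G: group G by fact
  obtain p q where p: "p \<in> carrier F2" and q: "q \<in> carrier F2"
    and left: "subst2 F2 p u v = gen 0" "subst2 F2 q u v = gen 1"
    and right: "subst2 F2 u p q = gen 0" "subst2 F2 v p q = gen 1"
    using automorphism_inverse_words[OF u v aut] .
  have left_group: "subst2 G p (subst2 G u a b) (subst2 G v a b) = a"
    "subst2 G q (subst2 G u a b) (subst2 G v a b) = b"
    if "a \<in> carrier G" "b \<in> carrier G" for a b
    using left subst2_subst2_F2[OF G u v that, of p] subst2_gen[OF G that]
      subst2_subst2_F2[OF G u v that, of q] by simp_all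
  have right_G: "subst2 G u (subst2 G p a b) (subst2 G q a b) = a"
    "subst2 G v (subst2 G p a b) (subst2 G q a b) = b"
    if "a \<in> carrier G" "b \<in> carrier G" for a b
    using right subst2_subst2_F2[OF G p q that, of u] subst2_gen[OF G that]
      subst2_subst2_F2[OF G p q that, of v] by simp_all
  interpret wada_words u v p q
  proof
    fix a b assume ab: "a \<in> carrier FU" "b \<in> carrier FU"
    show "subst2 FU u (subst2 FU p a b) (subst2 FU q a b) = a"
      using right subst2_subst2_F2[OF group_free_group p q ab, of u]
        subst2_gen[OF group_free_group ab] by simp
    show "subst2 FU v (subst2 FU p a b) (subst2 FU q a b) = b"
      using right subst2_subst2_F2[OF group_free_group p q ab, of v]
        subst2_gen[OF group_free_group ab] by simp
    fix c assume c: "c \<in> carrier FU"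
    note eqs = wada_conditions_in_group[OF group_free_group wada ab c]
    show "subst2 FU u (subst2 FU u a b) (subst2 FU u (subst2 FU v a b) c) =
      subst2 FU u a (subst2 FU u b c)" by (rule eqs)
    show "subst2 FU v (subst2 FU u a b) (subst2 FU u (subst2 FU v a b) c) =
      subst2 FU u (subst2 FU v a (subst2 FU u b c)) (subst2 FU v b c)" by (rule eqs)
    show "subst2 FU v (subst2 FU v a b) c =
      subst2 FU v (subst2 FU v a (subst2 FU u b c)) (subst2 FU v b c)" by (rule eqs)
  qed (use u v p q in auto)
  \<comment> \<open>Nontriviality of the pair enters here, ruling out the first alternative of
    \<open>u_shape\<close>.\<close>
  obtain r\<^sub>u b\<^sub>u s\<^sub>u where us: "u = r\<^sub>u @ [(1, b\<^sub>u)] @ s\<^sub>u" "fst ` set r\<^sub>u \<subseteq> {0}" "fst ` set s\<^sub>u \<subseteq> {0}"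
    using u_shape nontriv by blast
  obtain r\<^sub>v b\<^sub>v s\<^sub>v where vs: "v = r\<^sub>v @ [(0, b\<^sub>v)] @ s\<^sub>v" "fst ` set r\<^sub>v \<subseteq> {1}" "fst ` set s\<^sub>v \<subseteq> {1}"
    using v_shape nontriv by blast
  have u_eval: "subst2 G u a y = word_eval G ((\<lambda>_. a)(1 := y)) (r\<^sub>u @ [(1, b\<^sub>u)] @ s\<^sub>u)" for a y
    unfolding subst2_def us(1) using us(2,3) by (intro word_eval_cong) auto
  have v_eval: "subst2 G v x b = word_eval G ((\<lambda>_. b)(0 := x)) (r\<^sub>v @ [(0, b\<^sub>v)] @ s\<^sub>v)" for x b
    unfolding subst2_def vs(1) using vs(2,3) by (intro word_eval_cong) auto
  note closed = subst2_closed[OF G]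
  show ?thesis
    unfolding birack_def
  proof (intro conjI ballI)
    show "bij_betw (\<lambda>(x, y). (subst2 G u x y, subst2 G v x y))
      (carrier G \<times> carrier G) (carrier G \<times> carrier G)"
      by (rule bij_betw_byWitness[where f' = "\<lambda>(x, y). (subst2 G p x y, subst2 G q x y)"])
        (auto simp: left_group right_G closed)
    show "\<exists>!y. y \<in> carrier G \<and> fst (case (a, y) of (x, y) \<Rightarrow> (subst2 G u x y, subst2 G v x y)) = d"
      if "a \<in> carrier G" "d \<in> carrier G" for a d
      unfolding prod.case fst_conv u_eval
      using us that by (intro G.unique_solution_word) auto
    show "\<exists>!x. x \<in> carrier G \<and> snd (case (x, b) of (x, y) \<Rightarrow> (subst2 G u x y, subst2 G v x y)) = d"
      if "b \<in> carrier G" "d \<in> carrier G" for b d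
      unfolding prod.case snd_conv v_eval
      using vs that by (intro G.unique_solution_word) auto
  next
    fix t assume "t \<in> carrier G \<times> carrier G \<times> carrier G"
    then obtain a b c where "t = (a, b, c)" "a \<in> carrier G" "b \<in> carrier G" "c \<in> carrier G"
      by auto
    \<comment> \<open>The three components of the Yang-Baxter equation are Wada's three conditions,
      in the same order.\<close>
    then show "(R_times_id (\<lambda>(x, y). (subst2 G u x y, subst2 G v x y)) \<circ>
        id_times_R (\<lambda>(x, y). (subst2 G u x y, subst2 G v x y)) \<circ>
        R_times_id (\<lambda>(x, y). (subst2 G u x y, subst2 G v x y))) t =
      (id_times_R (\<lambda>(x, y). (subst2 G u x y, subst2 G v x y)) \<circ>
        R_times_id (\<lambda>(x, y). (subst2 G u x y, subst2 G v x y)) \<circ>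
        id_times_R (\<lambda>(x, y). (subst2 G u x y, subst2 G v x y))) t"
      using wada_conditions_in_group[OF G wada, of a b c]
      by (simp add: R_times_id_def id_times_R_def)
  qed
qed

section \<open>The two biquandles\<close>

context group
begin

text \<open>With products associated to the right and inverses distributed, these rules cancel
  adjacent inverse letters, so the simplifier can verify word identities.\<close>

lemma inv_cancel_left [simp]:
  "x \<in> carrier G \<Longrightarrow> y \<in> carrier G \<Longrightarrow> x \<otimes> (inv x \<otimes> y) = y"
  "x \<in> carrier G \<Longrightarrow> y \<in> carrier G \<Longrightarrow> inv x \<otimes> (x \<otimes> y) = y"
  by (simp_all add: m_assoc[symmetric])

lemma biquandle_inv:
  "biquandle (carrier G) (\<lambda>(x, y). (inv y, y \<otimes> x \<otimes> y))" (is "biquandle _ ?R")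
  unfolding biquandle_def birack_def
proof (intro conjI ballI)
  show "bij_betw ?R (carrier G \<times> carrier G) (carrier G \<times> carrier G)"
    \<comment> \<open>From c = y^{-1} and d = yxy one reads off x = cdc.\<close>
    by (rule bij_betw_byWitness[where f' = "\<lambda>(c, d). (c \<otimes> d \<otimes> c, inv c)"])
      (auto simp: m_assoc)
  show "\<exists>!y. y \<in> carrier G \<and> fst (?R (a, y)) = d" if "a \<in> carrier G" "d \<in> carrier G" for a d
    using that by (intro ex1I[of _ "inv d"]) auto
  show "\<exists>!x. x \<in> carrier G \<and> snd (?R (x, b)) = d" if "b \<in> carrier G" "d \<in> carrier G" for b d
    using that by (intro ex1I[of _ "inv b \<otimes> d \<otimes> inv b"]) (auto simp: m_assoc)
  show "(R_times_id ?R \<circ> id_times_R ?R \<circ> R_times_id ?R) t = (id_times_R ?R \<circ> R_times_id ?R \<circ> id_times_R ?R) t"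
    if "t \<in> carrier G \<times> carrier G \<times> carrier G" for t
    using that by (auto simp: R_times_id_def id_times_R_def m_assoc inv_mult_group)
  show "\<exists>!x. x \<in> carrier G \<and> x = fst (?R (x, a)) \<and> a = snd (?R (x, a))" if "a \<in> carrier G" for a
    using that by (intro ex1I[of _ "inv a"]) auto
  show "\<exists>!y. y \<in> carrier G \<and> y = snd (?R (a, y)) \<and> a = fst (?R (a, y))" if "a \<in> carrier G" for a
    using that by (intro ex1I[of _ "inv a"]) auto
qed

text \<open>Cancelling \<open>a\<close> leaves ax = 1. Both uniqueness claims of the second
  biquandle reduce to an equation of this form.\<close>

lemma eq_square_mult_imp_eq_inv:
  assumes "a \<in> carrier G" "x \<in> carrier G" "a = a [^] (2 :: nat) \<otimes> x"
  shows "x = inv a"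
proof -
  have "a \<otimes> (a \<otimes> x) = a"
    using assms(3)[symmetric] assms(1,2) by (simp add: numeral_2_eq_2 m_assoc)
  then have "a \<otimes> x = \<one>" using assms(1,2) by simp
  then show ?thesis using assms(1,2) by (metis inv_equality inv_inv)
qed

lemma biquandle_conj_inv:
  "biquandle (carrier G) (\<lambda>(x, y). (inv x \<otimes> inv y \<otimes> x, y [^] (2 :: nat) \<otimes> x))"
  (is "biquandle _ ?R")
proof -
  have pow2: "y [^] (2 :: nat) = y \<otimes> y" if "y \<in> carrier G" for y
    using that by (simp add: numeral_2_eq_2)
  show ?thesis
    unfolding biquandle_def birack_def
  proof (intro conjI ballI)
    show "bij_betw ?R (carrier G \<times> carrier G) (carrier G \<times> carrier G)"
      \<comment> \<open>With c = x^{-1}y^{-1}x and d = y^2 x one has c^2 = x^{-1}y^{-2}x, so dc^2 =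
        x; also dc^{-1} = y^3 x, so dc^{-1}d^{-1} = y.\<close>
      by (rule bij_betw_byWitness[where f' = "\<lambda>(c, d). (d \<otimes> c \<otimes> c, d \<otimes> inv c \<otimes> inv d)"])
        (auto simp: pow2 m_assoc inv_mult_group)
    show "\<exists>!y. y \<in> carrier G \<and> fst (?R (a, y)) = d" if "a \<in> carrier G" "d \<in> carrier G" for a d
      using that by (intro ex1I[of _ "a \<otimes> inv d \<otimes> inv a"]) (auto simp: m_assoc inv_mult_group)
    show "\<exists>!x. x \<in> carrier G \<and> snd (?R (x, b)) = d" if "b \<in> carrier G" "d \<in> carrier G" for b d
      using that by (intro ex1I[of _ "inv b \<otimes> (inv b \<otimes> d)"]) (auto simp: pow2 m_assoc)
    show "(R_times_id ?R \<circ> id_times_R ?R \<circ> R_times_id ?R) t =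
        (id_times_R ?R \<circ> R_times_id ?R \<circ> id_times_R ?R) t"
      if "t \<in> carrier G \<times> carrier G \<times> carrier G" for t
      using that by (auto simp: R_times_id_def id_times_R_def pow2 m_assoc inv_mult_group)
    show "\<exists>!x. x \<in> carrier G \<and> x = fst (?R (x, a)) \<and> a = snd (?R (x, a))" if "a \<in> carrier G" for a
    proof (rule ex1I[of _ "inv a"])
      fix x assume "x \<in> carrier G \<and> x = fst (?R (x, a)) \<and> a = snd (?R (x, a))"
      then have "x \<in> carrier G" "a = a [^] (2 :: nat) \<otimes> x"
        unfolding prod.case snd_conv by blast+
      with that show "x = inv a" by (rule eq_square_mult_imp_eq_inv)
    qed (use that in \<open>auto simp: pow2 m_assoc\<close>)
    show "\<exists>!y. y \<in> carrier G \<and> y = snd (?R (a, y)) \<and> a = fst (?R (a, y))" if "a \<in> carrier G" for a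
    proof (rule ex1I[of _ "inv a"])
      fix y assume "y \<in> carrier G \<and> y = snd (?R (a, y)) \<and> a = fst (?R (a, y))"
      then have y: "y \<in> carrier G" "y = y [^] (2 :: nat) \<otimes> a"
        unfolding prod.case snd_conv by blast+
      \<comment> \<open>Here \<open>y\<close> plays the part of the squared element and
        \<open>a\<close> that of the other factor.\<close>
      then have "a = inv y" using that by (intro eq_square_mult_imp_eq_inv)
      with y(1) show "y = inv a" by simp
    qed (use that in \<open>auto simp: pow2 m_assoc\<close>)
  qed
qed

end

theorem lemma3p3:
  fixes G :: "('g, 'm) monoid_scheme"
  assumes "group G"
  shows "(\<forall>u \<in> carrier F2. \<forall>v \<in> carrier F2.
            defines_automorphism u v \<and> wada_conditions u v \<and> \<not> (u = gen 0 \<and> v = gen 1) \<longrightarrow>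
            birack (carrier G) (\<lambda>(x, y). (subst2 G u x y, subst2 G v x y))) \<and>
         biquandle (carrier G)
           (\<lambda>(x, y). (inv\<^bsub>G\<^esub> y, y \<otimes>\<^bsub>G\<^esub> x \<otimes>\<^bsub>G\<^esub> y)) \<and>
         biquandle (carrier G)
           (\<lambda>(x, y). (inv\<^bsub>G\<^esub> x \<otimes>\<^bsub>G\<^esub> inv\<^bsub>G\<^esub> y \<otimes>\<^bsub>G\<^esub> x, y [^]\<^bsub>G\<^esub> (2::nat) \<otimes>\<^bsub>G\<^esub> x))"
proof (intro conjI ballI impI)
  fix u v
  assume "u \<in> carrier F2" "v \<in> carrier F2"
    and "defines_automorphism u v \<and> wada_conditions u v \<and> \<not> (u = gen 0 \<and> v = gen 1)"
  then show "birack (carrier G) (\<lambda>(x, y). (subst2 G u x y, subst2 G v x y))"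
    using birack_wada[OF assms] by simp
qed (rule group.biquandle_inv[OF assms], rule group.biquandle_conj_inv[OF assms])

end
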